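(* Let $\sigma:\{0,\dots,d-1\}\to\{1,\dots,d\}$ be any bijection, where $d=\max\{d_A,d_D\}$. Then the Fiedler pencil $\mathbb L_\sigma(\lambda)=\lambda\mathbb M_d-\mathbb M_\sigma$ is a Rosenbrock linearization of $\mathcal S(\lambda)$: there exist unimodular matrix polynomials $U_A(\lambda),V_A(\lambda)\in\mathbb C[\lambda]^{d_An\times d_An}$ and $U_D(\lambda),V_D(\lambda)\in\mathbb C[\lambda]^{d_Dm\times d_Dm}$ such that $$\begin{bmatrix}U_A&0\\0&U_D\end{bmatrix}\mathbb L_\sigma(\lambda)\begin{bmatrix}V_A&0\\0&V_D\end{bmatrix}=\begin{bmatrix}\mathrm{diag}(-I_{(d_A-1)n},A(\lambda)) & -(e_{d_A}e_{d_D}^T)\otimes B\\ (e_{d_D}e_{d_A}^T)\otimes C & \mathrm{diag}(-I_{(d_D-1)m},D(\lambda))\end{bmatrix},$$ and consequently $\mathbb L_\sigma(\lambda)$ is equivalent (via unimodular transformations) to $\mathrm{diag}(I_{(d_A-1)n},I_{(d_D-1)m},\mathcal S(\lambda))$. This holds whether $\mathcal S(\lambda)$ is regular or singular.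
   Context: Let $n,m,d_A,d_D\ge 1$, $A(\lambda)=\sum_{j=0}^{d_A}\lambda^jA_j\in\mathbb C[\lambda]^{n\times n}$, $D(\lambda)=\sum_{j=0}^{d_D}\lambda^jD_j\in\mathbb C[\lambda]^{m\times m}$, $B\in\mathbb C^{n\times m}$, $C\in\mathbb C^{m\times n}$, and $\mathcal S(\lambda)=\begin{bmatrix}A(\lambda)&-B\\ C& D(\lambda)\end{bmatrix}$. Let $d=\max\{d_A,d_D\}$. $e_k$ denotes the $k$-th standard basis column vector (of length $d_A$ or $d_D$, as dimensions require), $\otimes$ the Kronecker product. A square matrix polynomial is unimodular if its determinant is a nonzero constant. Fiedler matrices of $A$ (size $d_An\times d_An$): $M_{d_A}=\mathrm{diag}(A_{d_A},I_{(d_A-1)n})$, $M_0=\mathrm{diag}(I_{(d_A-1)n},-A_0)$, $M_i=\mathrm{diag}\big(I_{(d_A-i-1)n},\begin{bmatrix}-A_i&I_n\\ I_n&0\end{bmatrix},I_{(i-1)n}\big)$ for $1\le i\le d_A-1$, and by convention $M_i:=I_{d_An}$ for $d_A\le i\le d-1$. Fiedler matrices $N_0,\dots,N_{d_D}$ of $D$ (size $d_Dm\times d_Dm$) are defined identically with $D_i$, $m$, $d_D$ in place of $A_i$, $n$, $d_A$, and $N_i:=I_{d_Dm}$ for $d_D\le i\le d-1$. Fiedler matrices of $\mathcal S$: $\mathbb M_0=\begin{bmatrix}M_0&(e_{d_A}e_{d_D}^T)\otimes B\\ -(e_{d_D}e_{d_A}^T)\otimes C& N_0\end{bmatrix}$,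 $\mathbb M_i=\mathrm{diag}(M_i,N_i)$ for $1\le i\le d-1$, $\mathbb M_d=\mathrm{diag}(M_{d_A},N_{d_D})$. For a bijection $\sigma:\{0,\dots,d-1\}\to\{1,\dots,d\}$, $\mathbb M_\sigma:=\mathbb M_{\sigma^{-1}(1)}\mathbb M_{\sigma^{-1}(2)}\cdots\mathbb M_{\sigma^{-1}(d)}$, and $\mathbb L_\sigma(\lambda)=\lambda\mathbb M_d-\mathbb M_\sigma$ is the Fiedler pencil of $\mathcal S$ associated with $\sigma$. *)

theory Defs
  imports "Jordan_Normal_Form.Determinant" "HOL-Computational_Algebra.Polynomial"
begin

definition bdiag :: "'a::zero mat \<Rightarrow> 'a mat \<Rightarrow> 'a mat" where
  "bdiag X Y = four_block_mat X (0\<^sub>m (dim_row X) (dim_col Y)) (0\<^sub>m (dim_row Y) (dim_col X)) Y"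

definition kron :: "'a::times mat \<Rightarrow> 'a mat \<Rightarrow> 'a mat" where
  "kron X Y = mat (dim_row X * dim_row Y) (dim_col X * dim_col Y)
     (\<lambda>(i,j). X $$ (i div dim_row Y, j div dim_col Y) * Y $$ (i mod dim_row Y, j mod dim_col Y))"

text \<open>k-th standard basis column vector of length len (1-based index k).\<close>
definition ecol :: "nat \<Rightarrow> nat \<Rightarrow> 'a::{zero,one} mat" where
  "ecol len k = mat len 1 (\<lambda>(i,j). if i = k - 1 then 1 else 0)"

definition cpoly_mat :: "complex mat \<Rightarrow> complex poly mat" where
  "cpoly_mat X = map_mat (\<lambda>x. [:x:]) X"

definition lam_mat :: "complex mat \<Rightarrow> complex poly mat" where
  "lam_mat X = map_mat (\<lambda>x. monom x 1) X"

definition mat_poly :: "nat \<Rightarrow> nat \<Rightarrow> (nat \<Rightarrow> complex mat) \<Rightarrow> complex poly mat" where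
  "mat_poly k deg Co = mat k k (\<lambda>(i,j). \<Sum>l\<le>deg. monom (Co l $$ (i,j)) l)"

definition unimodular :: "nat \<Rightarrow> complex poly mat \<Rightarrow> bool" where
  "unimodular k U \<longleftrightarrow> U \<in> carrier_mat k k \<and> (\<exists>c. c \<noteq> 0 \<and> det U = [:c:])"

definition fiedler :: "(nat \<Rightarrow> complex mat) \<Rightarrow> nat \<Rightarrow> nat \<Rightarrow> nat \<Rightarrow> complex mat" where
  "fiedler Co k dg i =
    (if i = 0 then bdiag (1\<^sub>m ((dg - 1) * k)) (- Co 0)
     else if i < dg then
       bdiag (1\<^sub>m ((dg - i - 1) * k))
         (bdiag (four_block_mat (- Co i) (1\<^sub>m k) (1\<^sub>m k) (0\<^sub>m k k)) (1\<^sub>m ((i - 1) * k)))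
     else 1\<^sub>m (dg * k))"

definition fiedler_lead :: "(nat \<Rightarrow> complex mat) \<Rightarrow> nat \<Rightarrow> nat \<Rightarrow> complex mat" where
  "fiedler_lead Co k dg = bdiag (Co dg) (1\<^sub>m ((dg - 1) * k))"

definition sys_fiedler ::
  "(nat \<Rightarrow> complex mat) \<Rightarrow> (nat \<Rightarrow> complex mat) \<Rightarrow> complex mat \<Rightarrow> complex mat
   \<Rightarrow> nat \<Rightarrow> nat \<Rightarrow> nat \<Rightarrow> nat \<Rightarrow> nat \<Rightarrow> complex mat" where
  "sys_fiedler Ac Dc B C n m dA dD i =
    (if i = 0 then
       four_block_mat (fiedler Ac n dA 0)
         (kron (ecol dA dA * transpose_mat (ecol dD dD)) B)
         (- kron (ecol dD dD * transpose_mat (ecol dA dA)) C)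
         (fiedler Dc m dD 0)
     else bdiag (fiedler Ac n dA i) (fiedler Dc m dD i))"

definition sys_fiedler_lead ::
  "(nat \<Rightarrow> complex mat) \<Rightarrow> (nat \<Rightarrow> complex mat) \<Rightarrow> nat \<Rightarrow> nat \<Rightarrow> nat \<Rightarrow> nat \<Rightarrow> complex mat" where
  "sys_fiedler_lead Ac Dc n m dA dD = bdiag (fiedler_lead Ac n dA) (fiedler_lead Dc m dD)"

definition sys_fiedler_prod ::
  "(nat \<Rightarrow> complex mat) \<Rightarrow> (nat \<Rightarrow> complex mat) \<Rightarrow> complex mat \<Rightarrow> complex mat
   \<Rightarrow> nat \<Rightarrow> nat \<Rightarrow> nat \<Rightarrow> nat \<Rightarrow> (nat \<Rightarrow> nat) \<Rightarrow> complex mat" where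
  "sys_fiedler_prod Ac Dc B C n m dA dD \<sigma> =
    (let d = max dA dD in
     foldr (\<lambda>k P. sys_fiedler Ac Dc B C n m dA dD (the_inv_into {0..<d} \<sigma> k) * P)
       [1..<d+1] (1\<^sub>m (dA * n + dD * m)))"

definition fiedler_pencil ::
  "(nat \<Rightarrow> complex mat) \<Rightarrow> (nat \<Rightarrow> complex mat) \<Rightarrow> complex mat \<Rightarrow> complex mat
   \<Rightarrow> nat \<Rightarrow> nat \<Rightarrow> nat \<Rightarrow> nat \<Rightarrow> (nat \<Rightarrow> nat) \<Rightarrow> complex poly mat" where
  "fiedler_pencil Ac Dc B C n m dA dD \<sigma> =
     lam_mat (sys_fiedler_lead Ac Dc n m dA dD) - cpoly_mat (sys_fiedler_prod Ac Dc B C n m dA dD \<sigma>)"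

end

theory Submission
  imports Defs
begin

text \<open>The coupling blocks of the pencil are \<open>L\<^sub>A (e e\<^sup>T \<otimes> B) R\<^sub>D\<close> and \<open>L\<^sub>D (e e\<^sup>T \<otimes> C) R\<^sub>A\<close>, where \<open>L\<close> and \<open>R\<close>
  are the products of the Fiedler matrices left and right of the one of index 0. So \<open>A\<close> and \<open>D\<close> can be
  treated separately, provided the transformations also satisfy \<open>U L (e \<otimes> I) = e \<otimes> I\<close> and
  \<open>(e\<^sup>T \<otimes> I) R V = e\<^sup>T \<otimes> I\<close>. For a single polynomial one inducts on the degree \<open>d\<close>: the factor \<open>M\<^sub>d\<^sub>-\<^sub>1\<close>
  commutes with all factors but \<open>M\<^sub>d\<^sub>-\<^sub>2\<close> and can be moved to the left or right end of the product; an explicit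
  unimodular transformation then splits off a block \<open>-I\<close> and leaves the pencil of the same permutation for
  degree \<open>d - 1\<close>, with leading block \<open>\<lambda> A\<^sub>d\<close> replaced by its Horner successor
  \<open>\<lambda> (\<lambda> A\<^sub>d + A\<^sub>d\<^sub>-\<^sub>1)\<close>.\<close>

section \<open>Matrix algebra with dimension side conditions\<close>

lemma mat_mult_assoc_dim:
  fixes X :: "'a::semiring_0 mat"
  shows "dim_col X = dim_row Y \<Longrightarrow> dim_col Y = dim_row Z \<Longrightarrow> X * Y * Z = X * (Y * Z)"
  by (rule assoc_mult_mat) auto

lemma mat_mult_distrib_dim:
  fixes X :: "'a::ring mat"
  shows "dim_row Y = dim_row Z \<Longrightarrow> dim_col Y = dim_col Z \<Longrightarrow> dim_col X = dim_row Y \<Longrightarrow> X * (Y + Z) = X * Y + X * Z"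
    and "dim_row Y = dim_row Z \<Longrightarrow> dim_col Y = dim_col Z \<Longrightarrow> dim_col Y = dim_row X \<Longrightarrow> (Y + Z) * X = Y * X + Z * X"
    and "dim_row Y = dim_row Z \<Longrightarrow> dim_col Y = dim_col Z \<Longrightarrow> dim_col X = dim_row Y \<Longrightarrow> X * (Y - Z) = X * Y - X * Z"
    and "dim_row Y = dim_row Z \<Longrightarrow> dim_col Y = dim_col Z \<Longrightarrow> dim_col Y = dim_row X \<Longrightarrow> (Y - Z) * X = Y * X - Z * X"
    and "dim_col X = dim_row Y \<Longrightarrow> X * (- Y) = - (X * Y)"
    and "dim_col Y = dim_row X \<Longrightarrow> (- Y) * X = - (Y * X)"
  by (auto intro!: mult_add_distrib_mat add_mult_distrib_mat mult_minus_distrib_mat minus_mult_distrib_mat)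

lemma mat_mult_smult_dim:
  fixes X :: "'a::comm_ring_1 mat"
  shows "dim_col X = dim_row Y \<Longrightarrow> X * (c \<cdot>\<^sub>m Y) = c \<cdot>\<^sub>m (X * Y)"
    and "dim_col X = dim_row Y \<Longrightarrow> (c \<cdot>\<^sub>m X) * Y = c \<cdot>\<^sub>m (X * Y)"
  by (auto intro: mult_smult_distrib mult_smult_assoc_mat)

lemma mat_one_zero_dim:
  fixes X :: "'a::comm_ring_1 mat"
  shows "dim_row X = a \<Longrightarrow> 1\<^sub>m a * X = X"
    and "dim_col X = a \<Longrightarrow> X * 1\<^sub>m a = X"
    and "dim_row X = b \<Longrightarrow> 0\<^sub>m a b * X = 0\<^sub>m a (dim_col X)"
    and "dim_col X = b \<Longrightarrow> X * 0\<^sub>m b a = 0\<^sub>m (dim_row X) a"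
  by (auto intro!: left_mult_one_mat' right_mult_one_mat' left_mult_zero_mat right_mult_zero_mat)

lemma four_block_mult_dim:
  fixes A1 :: "'a::comm_ring_1 mat"
  assumes "dim_row B1 = dim_row A1" "dim_col C1 = dim_col A1" "dim_row D1 = dim_row C1" "dim_col D1 = dim_col B1"
    and "dim_row B2 = dim_row A2" "dim_col C2 = dim_col A2" "dim_row D2 = dim_row C2" "dim_col D2 = dim_col B2"
    and "dim_row A2 = dim_col A1" "dim_row C2 = dim_col B1"
  shows "four_block_mat A1 B1 C1 D1 * four_block_mat A2 B2 C2 D2
    = four_block_mat (A1 * A2 + B1 * C2) (A1 * B2 + B1 * D2) (C1 * A2 + D1 * C2) (C1 * B2 + D1 * D2)"
  by (rule mult_four_block_mat) (use assms in auto)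

text \<open>The premises of these rules are equations between dimensions instead of carrier
  memberships, so that the simplifier can discharge them from facts about \<open>dim_row\<close> and
  \<open>dim_col\<close>.\<close>

lemmas mat_dim_simps = mat_mult_assoc_dim mat_mult_distrib_dim mat_mult_smult_dim mat_one_zero_dim
  four_block_mult_dim

section \<open>Block diagonal matrices\<close>

lemma dim_bdiag [simp]:
  "dim_row (bdiag X Y) = dim_row X + dim_row Y" "dim_col (bdiag X Y) = dim_col X + dim_col Y"
  by (auto simp: bdiag_def)

lemma bdiag_carrier:
  "X \<in> carrier_mat a b \<Longrightarrow> Y \<in> carrier_mat c d \<Longrightarrow> bdiag X Y \<in> carrier_mat (a + c) (b + d)"
  by (auto simp: bdiag_def)

lemma bdiag_mult:
  fixes X :: "'a::comm_ring_1 mat"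
  assumes "dim_col X = dim_row X'" "dim_col Y = dim_row Y'"
  shows "bdiag X Y * bdiag X' Y' = bdiag (X * X') (Y * Y')"
proof -
  have "X * X' + 0\<^sub>m (dim_row X) (dim_col X') = X * X'" "0\<^sub>m (dim_row Y) (dim_col Y') + Y * Y' = Y * Y'"
    by (rule right_add_zero_mat left_add_zero_mat; auto)+
  then show ?thesis using assms by (simp add: bdiag_def mat_dim_simps)
qed

lemma bdiag_one: "bdiag (1\<^sub>m a) (1\<^sub>m b) = 1\<^sub>m (a + b)"
  by (simp add: bdiag_def)

lemma bdiag_zero: "bdiag (0\<^sub>m a b) (0\<^sub>m c d) = 0\<^sub>m (a + c) (b + d)"
  by (simp add: bdiag_def)

lemma bdiag_assoc: "bdiag (bdiag X Y) Z = bdiag X (bdiag Y Z)"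
  unfolding bdiag_def by (rule assoc_four_block_mat[symmetric])

lemma bdiag_empty: "bdiag (1\<^sub>m 0) X = X" "bdiag (0\<^sub>m 0 0) X = X"
  by (auto simp: bdiag_def intro!: eq_matI)

lemma bdiag_uminus:
  fixes X :: "'a::comm_ring_1 mat"
  shows "bdiag (- X) (- Y) = - bdiag X Y"
  by (rule eq_matI) (auto simp: bdiag_def)

lemma map_mat_bdiag: "f 0 = 0 \<Longrightarrow> map_mat f (bdiag X Y) = bdiag (map_mat f X) (map_mat f Y)"
  by (rule eq_matI) (auto simp: bdiag_def)

section \<open>Unimodular matrices\<close>

lemma unimodular_one: "unimodular k (1\<^sub>m k)"
  by (auto simp: unimodular_def intro!: exI[of _ 1])

lemma unimodular_mult: "unimodular k U \<Longrightarrow> unimodular k V \<Longrightarrow> unimodular k (U * V)"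
  by (force simp: unimodular_def det_mult)

lemma unimodular_bdiag:
  assumes "unimodular a U" "unimodular b V"
  shows "unimodular (a + b) (bdiag U V)"
proof -
  have *: "U \<in> carrier_mat a a" "V \<in> carrier_mat b b" using assms by (auto simp: unimodular_def)
  then have "det (bdiag U V) = det U * det V"
    unfolding bdiag_def by (intro det_four_block_mat_lower_left_zero) auto
  with assms bdiag_carrier[OF *] show ?thesis by (force simp: unimodular_def)
qed

text \<open>The determinants multiply to 1, and the units among the complex polynomials are the
  nonzero constants.\<close>

lemma unimodular_if_inverse:
  assumes "U \<in> carrier_mat k k" "V \<in> carrier_mat k k" "U * V = 1\<^sub>m k"
  shows "unimodular k U" "unimodular k V"
proof -
  have *: "det U * det V = 1" using assms det_mult[of U k V] by simp
  have unit: "\<exists>c. c \<noteq> 0 \<and> p = [:c:]" if dvd: "p dvd 1" for p :: "complex poly"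
  proof -
    from dvd obtain c where c: "p = [:c:]" "c dvd 1" by (elim is_unit_polyE)
    then have "c \<noteq> 0" by auto
    with c show ?thesis by blast
  qed
  from * have "det U dvd 1" "det V dvd 1" by (metis dvdI, metis dvdI mult.commute)
  with unit assms show "unimodular k U" "unimodular k V" by (auto simp: unimodular_def)
qed

section \<open>One reduction step\<close>

text \<open>\<open>E\<close> and \<open>Et\<close> are the first block column and row of the identity and \<open>J = I - E Et\<close>, so that
  \<open>[[-A, Et], [E, J]]\<close> is the Fiedler matrix carrying the coefficient \<open>A\<close> and
  \<open>diag (1, W)\<close> the product of the remaining ones.\<close>

context
  fixes k N :: nat and X Y A E Et J W :: "'a::comm_ring_1 mat" and t :: 'a
  assumes car: "X \<in> carrier_mat k k" "A \<in> carrier_mat k k" "E \<in> carrier_mat N k" "Et \<in> carrier_mat k N"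
      "J \<in> carrier_mat N N" "W \<in> carrier_mat N N"
    and rel: "Et * E = 1\<^sub>m k" "Et * J = 0\<^sub>m k N" "J * E = 0\<^sub>m N k" "J * J = J" "E * Et = 1\<^sub>m N - J"
begin

private lemma dims [simp]: "dim_row X = k" "dim_col X = k" "dim_row A = k" "dim_col A = k" "dim_row E = N" "dim_col E = k"
  "dim_row Et = k" "dim_col Et = N" "dim_row J = N" "dim_col J = N" "dim_row W = N" "dim_col W = N"
  using car by auto

text \<open>Simplification nests products to the right and hides a pair such as
  \<open>Et * E\<close> inside \<open>Et * (E * Z)\<close>; the relations are therefore repeated
  with a trailing factor.\<close>

private lemma rel_assoc:
  "dim_row Z = k \<Longrightarrow> Et * (E * Z) = Z"
  "dim_row Z = N \<Longrightarrow> Et * (J * Z) = 0\<^sub>m k (dim_col Z)"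
  "dim_row Z = k \<Longrightarrow> J * (E * Z) = 0\<^sub>m N (dim_col Z)"
  "dim_row Z = N \<Longrightarrow> J * (J * Z) = J * Z"
  "dim_row Z = N \<Longrightarrow> E * (Et * Z) = Z - J * Z"
  by (simp_all add: mat_mult_assoc_dim[symmetric] rel mat_one_zero_dim) (simp add: mat_dim_simps)

lemmas block_simps = mat_dim_simps rel rel_assoc

text \<open>For the intended \<open>E\<close>, \<open>Et\<close> and \<open>J\<close> this is the
  permutation matrix exchanging the first two blocks. The lower right block of the square is E Et +
  J, the identity.\<close>

lemma swap_involution:
  "four_block_mat (0\<^sub>m k k) Et E J * four_block_mat (0\<^sub>m k k) Et E J = 1\<^sub>m (k + N)"
proof -
  have *: "1\<^sub>m N - J + J = 1\<^sub>m N" by (rule eq_matI) auto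
  have "0\<^sub>m k N + 0\<^sub>m k N = (0\<^sub>m k N :: 'a mat)" "0\<^sub>m N k + 0\<^sub>m N k = (0\<^sub>m N k :: 'a mat)"
    "0\<^sub>m k k + 1\<^sub>m k = (1\<^sub>m k :: 'a mat)" by auto
  then show ?thesis by (simp add: block_simps *)
qed

text \<open>The shear turns the lower right entry t I - J W into t J - J W. As \<open>Et * J\<close>
  is 0, the swap then puts -I into the top left corner with a zero beside it, while its term
  \<open>E * (Y * Et)\<close> cancels the entry E Y below. The last corner collects t E Y Et + t J -
  (E Et + J) W.\<close>

lemma left_step:
  "four_block_mat (0\<^sub>m k k) Et E (J + E * (Y * Et)) *
     ((bdiag X (t \<cdot>\<^sub>m 1\<^sub>m N) - four_block_mat (- A) Et E J * bdiag (1\<^sub>m k) W) *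
     four_block_mat (1\<^sub>m k) (t \<cdot>\<^sub>m Et) (0\<^sub>m N k) (1\<^sub>m N))
   = bdiag (- 1\<^sub>m k) (t \<cdot>\<^sub>m (E * (Y * Et) + J) - W)" if Y: "Y = X + A"
proof -
  have dY [simp]: "dim_row Y = k" "dim_col Y = k" by (simp_all add: Y)
  have 1: "bdiag X (t \<cdot>\<^sub>m 1\<^sub>m N) - four_block_mat (- A) Et E J * bdiag (1\<^sub>m k) W
     = four_block_mat Y (- (Et * W)) (- E) (t \<cdot>\<^sub>m 1\<^sub>m N - J * W)"
    unfolding Y bdiag_def
    by (simp add: block_simps) (rule eq_matI; simp del: index_mult_mat(1))
  have 2: "\<dots> * four_block_mat (1\<^sub>m k) (t \<cdot>\<^sub>m Et) (0\<^sub>m N k) (1\<^sub>m N)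
     = four_block_mat Y (t \<cdot>\<^sub>m (Y * Et) - Et * W) (- E) (t \<cdot>\<^sub>m J - J * W)"
    by (simp add: block_simps)
      (rule cong_four_block_mat; rule eq_matI; simp del: index_mult_mat(1) add: algebra_simps)
  show ?thesis unfolding 1 2 unfolding bdiag_def
    by (simp add: block_simps)
      (rule cong_four_block_mat; rule eq_matI; simp del: index_mult_mat(1) add: algebra_simps)
qed

text \<open>The mirror image of \<open>left_step\<close>: the shear acts on rows and the swap on
  columns.\<close>

lemma right_step:
  "(four_block_mat (1\<^sub>m k) (0\<^sub>m k N) (t \<cdot>\<^sub>m E) (1\<^sub>m N) *
     (bdiag X (t \<cdot>\<^sub>m 1\<^sub>m N) - bdiag (1\<^sub>m k) W * four_block_mat (- A) Et E J)) *
     four_block_mat (0\<^sub>m k k) Et E (J + E * (Y * Et))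
   = bdiag (- 1\<^sub>m k) (t \<cdot>\<^sub>m (E * (Y * Et) + J) - W)" if Y: "Y = X + A"
proof -
  have dY [simp]: "dim_row Y = k" "dim_col Y = k" by (simp_all add: Y)
  have 1: "bdiag X (t \<cdot>\<^sub>m 1\<^sub>m N) - bdiag (1\<^sub>m k) W * four_block_mat (- A) Et E J
     = four_block_mat Y (- Et) (- (W * E)) (t \<cdot>\<^sub>m 1\<^sub>m N - W * J)"
    unfolding Y bdiag_def
    by (simp add: block_simps) (rule eq_matI; simp del: index_mult_mat(1))
  have 2: "four_block_mat (1\<^sub>m k) (0\<^sub>m k N) (t \<cdot>\<^sub>m E) (1\<^sub>m N) * \<dots>
     = four_block_mat Y (- Et) (t \<cdot>\<^sub>m (E * Y) - W * E) (t \<cdot>\<^sub>m J - W * J)"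
    by (simp add: block_simps)
      (rule cong_four_block_mat; rule eq_matI; simp del: index_mult_mat(1) add: algebra_simps)
  show ?thesis unfolding 1 2 unfolding bdiag_def
    by (simp add: block_simps)
      (rule cong_four_block_mat; rule eq_matI; simp del: index_mult_mat(1) add: algebra_simps)
qed

text \<open>Where the first block column vanishes, the swap cancels the Fiedler matrix for every
  \<open>Y\<close> and \<open>A\<close>, again because E Et + J is the identity. This carries the
  coupling conditions through the step.\<close>

lemma left_step_fix:
  "four_block_mat (0\<^sub>m k k) Et E (J + E * (Y * Et)) * (four_block_mat (- A) Et E J * bdiag (0\<^sub>m k k) W)
   = bdiag (0\<^sub>m k k) W"  if "dim_row Y = k" "dim_col Y = k"
  unfolding bdiag_def using that
  by (simp add: block_simps)
    (rule cong_four_block_mat; rule eq_matI; simp del: index_mult_mat(1) add: algebra_simps)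

lemma right_step_fix:
  "(bdiag (0\<^sub>m k k) W * four_block_mat (- A) Et E J) * four_block_mat (0\<^sub>m k k) Et E (J + E * (Y * Et))
   = bdiag (0\<^sub>m k k) W"  if "dim_row Y = k" "dim_col Y = k"
  unfolding bdiag_def using that
  by (simp add: block_simps)
    (rule cong_four_block_mat; rule eq_matI; simp del: index_mult_mat(1) add: algebra_simps)

text \<open>The shears only add multiples of the first block column or block row, which is zero
  here.\<close>

lemma shear_fix:
  "bdiag (0\<^sub>m k k) W * four_block_mat (1\<^sub>m k) (t \<cdot>\<^sub>m Et) (0\<^sub>m N k) (1\<^sub>m N) = bdiag (0\<^sub>m k k) W"
  "four_block_mat (1\<^sub>m k) (0\<^sub>m k N) (t \<cdot>\<^sub>m E) (1\<^sub>m N) * bdiag (0\<^sub>m k k) W = bdiag (0\<^sub>m k k) W"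
  unfolding bdiag_def
  by (simp add: block_simps; (rule cong_four_block_mat; rule eq_matI; simp del: index_mult_mat(1)))+

text \<open>Used for unimodularity: the transformation is an involution times a shear.\<close>

lemma step_factorization:
  "four_block_mat (0\<^sub>m k k) Et E (J + E * (Y * Et))
   = four_block_mat (0\<^sub>m k k) Et E J * four_block_mat (1\<^sub>m k) (Y * Et) (0\<^sub>m N k) (1\<^sub>m N)"
  if "dim_row Y = k" "dim_col Y = k"
  using that by (simp add: block_simps)
   (rule cong_four_block_mat; rule eq_matI; simp del: index_mult_mat(1) add: algebra_simps)

end

lemma shear_inverse:
  fixes Z :: "'a::comm_ring_1 mat"
  shows "Z \<in> carrier_mat k N \<Longrightarrow> four_block_mat (1\<^sub>m k) Z (0\<^sub>m N k) (1\<^sub>m N) * four_block_mat (1\<^sub>m k) (- Z) (0\<^sub>m N k) (1\<^sub>m N) = 1\<^sub>m (k + N)"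
    and "Z \<in> carrier_mat N k \<Longrightarrow> four_block_mat (1\<^sub>m k) (0\<^sub>m k N) Z (1\<^sub>m N) * four_block_mat (1\<^sub>m k) (0\<^sub>m k N) (- Z) (1\<^sub>m N) = 1\<^sub>m (k + N)"
  unfolding four_block_one_mat[symmetric]
  subgoal by (simp add: mat_dim_simps del: four_block_one_mat) (rule cong_four_block_mat; rule eq_matI; simp)
  subgoal by (simp add: mat_dim_simps del: four_block_one_mat) (rule cong_four_block_mat; rule eq_matI; simp)
  done

section \<open>Products of Fiedler matrices\<close>

text \<open>The factors are listed by index because, for positive \<open>d\<close>, indices from
  \<open>d\<close> on contribute identities: one list serves both polynomials and every degree of
  the induction.\<close>

definition fprod :: "(nat \<Rightarrow> complex mat) \<Rightarrow> nat \<Rightarrow> nat \<Rightarrow> nat list \<Rightarrow> complex mat" where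
  "fprod Co k d zs = foldr (\<lambda>i P. fiedler Co k d i * P) zs (1\<^sub>m (d * k))"

text \<open>\<open>proj_last k d\<close> is \<open>(e\<^sub>d e\<^sub>d\<^sup>T) \<otimes> I\<^sub>k\<close>. The conditions \<open>U L (e\<^sub>d \<otimes> I) = e\<^sub>d \<otimes> I\<close> and
  \<open>(e\<^sub>d\<^sup>T \<otimes> I) R V = e\<^sub>d\<^sup>T \<otimes> I\<close> are stated with this projection in place of the block column, so that
  all matrices stay square.\<close>

definition proj_last :: "nat \<Rightarrow> nat \<Rightarrow> 'a::{zero,one} mat" where
  "proj_last k d = bdiag (0\<^sub>m ((d - 1) * k) ((d - 1) * k)) (1\<^sub>m k)"

lemma proj_last_carrier [simp]: "d \<ge> 1 \<Longrightarrow> proj_last k d \<in> carrier_mat (d * k) (d * k)"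
  by (cases d) (auto simp: proj_last_def intro!: carrier_matI)

lemma dim_proj_last [simp]:
  "d \<ge> 1 \<Longrightarrow> dim_row (proj_last k d) = d * k" "d \<ge> 1 \<Longrightarrow> dim_col (proj_last k d) = d * k"
  by (rule proj_last_carrier[THEN carrier_matD(1)] proj_last_carrier[THEN carrier_matD(2)]; assumption)+

lemma proj_last_Suc: "d \<ge> 1 \<Longrightarrow> proj_last k (Suc d) = bdiag (0\<^sub>m k k) (proj_last k d)"
  by (cases d) (auto simp: proj_last_def bdiag_assoc[symmetric] bdiag_zero)

lemma fiedler_carrier:
  assumes "d \<ge> 1" "\<forall>j<d. Co j \<in> carrier_mat k k"
  shows "fiedler Co k d i \<in> carrier_mat (d * k) (d * k)"
proof -
  obtain e where d: "d = Suc e" using assms by (cases d) auto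
  consider "i = 0" | "i \<noteq> 0" "i < d" "d = d - i - 1 + 2 + (i - 1)" | "i \<ge> d" by linarith
  then show ?thesis
  proof cases
    case 1
    then show ?thesis using assms by (auto simp: fiedler_def d intro!: carrier_matI)
  next
    case 2
    \<comment> \<open>The three diagonal parts consist of \<open>d - i - 1\<close>, 2 and
      \<open>i - 1\<close> blocks of size \<open>k\<close>.\<close>
    have "d * k = (d - i - 1) * k + (2 * k + (i - 1) * k)"
      by (subst 2(3)) (simp only: add_mult_distrib)
    then show ?thesis using 2 assms by (auto simp: fiedler_def intro!: carrier_matI)
  next
    case 3
    then show ?thesis using assms by (auto simp: fiedler_def)
  qed
qed

text \<open>Raising the degree lengthens the leading identity by one block. Index \<open>d\<close>
  is the exception: it gives the identity in degree \<open>d\<close> but a genuine factor in degree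
  \<open>Suc d\<close>.\<close>

lemma fiedler_Suc:
  assumes "d \<ge> 1" "i \<noteq> d"
  shows "fiedler Co k (Suc d) i = bdiag (1\<^sub>m k) (fiedler Co k d i)"
proof -
  obtain e where d: "d = Suc e" using assms by (cases d) auto
  have *: "i < d \<Longrightarrow> (Suc d - i - 1) * k = k + (d - i - 1) * k" by (simp add: Suc_diff_le d flip: mult_Suc)
  show ?thesis using assms *
    by (auto simp: fiedler_def d bdiag_one bdiag_assoc[symmetric])
qed

lemma fprod_Nil: "fprod Co k d [] = 1\<^sub>m (d * k)"
  and fprod_Cons: "fprod Co k d (i # zs) = fiedler Co k d i * fprod Co k d zs"
  by (simp_all add: fprod_def)

lemma fprod_carrier:
  assumes "d \<ge> 1" "\<forall>j<d. Co j \<in> carrier_mat k k"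
  shows "fprod Co k d zs \<in> carrier_mat (d * k) (d * k)"
  using fiedler_carrier[OF assms] by (induction zs) (auto simp: fprod_Nil fprod_Cons intro!: mult_carrier_mat)

lemma fprod_append:
  assumes "d \<ge> 1" "\<forall>j<d. Co j \<in> carrier_mat k k"
  shows "fprod Co k d (xs @ ys) = fprod Co k d xs * fprod Co k d ys"
proof (induction xs)
  case (Cons x xs)
  then show ?case
    using assoc_mult_mat[OF fiedler_carrier[OF assms] fprod_carrier[OF assms] fprod_carrier[OF assms]]
    by (simp add: fprod_Cons)
qed (simp add: fprod_Nil left_mult_one_mat[OF fprod_carrier[OF assms]])

section \<open>Moving the factor of highest index to one end of the product\<close>

context
  fixes Co :: "nat \<Rightarrow> complex mat" and k d :: nat
  assumes d: "d \<ge> 1" and Co: "\<forall>j\<le>d. Co j \<in> carrier_mat k k"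
begin

private lemma Co1: "\<forall>j<Suc d. Co j \<in> carrier_mat k k" and Co0: "\<forall>j<d. Co j \<in> carrier_mat k k"
  and d1: "Suc d \<ge> 1"
  using Co by auto

private abbreviation (input) "F \<equiv> fprod Co k (Suc d)"
private abbreviation (input) "G \<equiv> fprod Co k d"
private abbreviation (input) "M \<equiv> fiedler Co k (Suc d) d"
private abbreviation (input) "bd1 \<equiv> bdiag (1\<^sub>m k :: complex mat)"
private abbreviation (input) "bd0 \<equiv> bdiag (0\<^sub>m k k :: complex mat)"

lemma dim_fprod [simp]: "dim_row (F zs) = k + d * k" "dim_col (F zs) = k + d * k"
  "dim_row (G zs) = d * k" "dim_col (G zs) = d * k"
  "dim_row (fiedler Co k (Suc d) i) = k + d * k" "dim_col (fiedler Co k (Suc d) i) = k + d * k"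
  "dim_row (fiedler Co k d i) = d * k" "dim_col (fiedler Co k d i) = d * k"
  "dim_row (proj_last k d) = d * k" "dim_col (proj_last k d) = d * k"
  using fprod_carrier[OF d1 Co1, THEN carrier_matD(1)] fprod_carrier[OF d Co0, THEN carrier_matD(1)]
    fprod_carrier[OF d1 Co1, THEN carrier_matD(2)] fprod_carrier[OF d Co0, THEN carrier_matD(2)]
    fiedler_carrier[OF d1 Co1, THEN carrier_matD(1)] fiedler_carrier[OF d Co0, THEN carrier_matD(1)]
    fiedler_carrier[OF d1 Co1, THEN carrier_matD(2)] fiedler_carrier[OF d Co0, THEN carrier_matD(2)] d
  by simp_all

lemma fprod_Suc: "d \<notin> set zs \<Longrightarrow> F zs = bd1 (G zs)"
  by (induction zs) (auto simp: fprod_Nil fprod_Cons bdiag_one bdiag_mult fiedler_Suc[OF d] mat_one_zero_dim)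

text \<open>In degree \<open>d\<close> the factor of index \<open>d\<close> is the identity, so the
  index may stay in the list when the degree drops.\<close>

lemma fprod_diag: "G (xs @ d # ys) = G xs * G ys"
proof -
  have "fiedler Co k d d = 1\<^sub>m (d * k)" using d by (simp add: fiedler_def)
  then show ?thesis by (simp add: fprod_append[OF d Co0] fprod_Cons mat_one_zero_dim)
qed

lemma M_eq: "M = bdiag (four_block_mat (- Co d) (1\<^sub>m k) (1\<^sub>m k) (0\<^sub>m k k)) (1\<^sub>m ((d - 1) * k))"
  using d by (simp add: fiedler_def bdiag_empty)

lemma bdiag_two: "bdiag X (bdiag X Z) = bdiag (bdiag X X) Z" by (simp add: bdiag_assoc)

text \<open>\<open>M\<close> differs from the identity only in the first two blocks, whereas the
  other factor starts with two identity blocks unless \<open>i\<close> is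
  \<open>d - 1\<close>.\<close>

lemma M_commute1: "i \<noteq> d - 1 \<Longrightarrow> M * bd1 (fiedler Co k d i) = bd1 (fiedler Co k d i) * M"
proof -
  assume i: "i \<noteq> d - 1"
  have car: "Co d \<in> carrier_mat k k" using Co by simp
  have "\<exists>Q. Q \<in> carrier_mat ((d - 1) * k) ((d - 1) * k) \<and> fiedler Co k d i = bd1 Q"
  proof (cases "i < d")
    case True
    with i d have e: "d - 1 \<ge> 1" by linarith
    then have "fiedler Co k (Suc (d - 1)) i = bd1 (fiedler Co k (d - 1) i)" using i by (intro fiedler_Suc) auto
    moreover have "fiedler Co k (d - 1) i \<in> carrier_mat ((d - 1) * k) ((d - 1) * k)"
      using e Co0 by (intro fiedler_carrier) auto
    ultimately show ?thesis using d by auto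
  next
    case False
    then have "fiedler Co k d i = 1\<^sub>m (d * k)" using d by (simp add: fiedler_def)
    also have "\<dots> = bd1 (1\<^sub>m ((d - 1) * k))" using d by (cases d) (auto simp: bdiag_one)
    finally show ?thesis by (intro exI[of _ "1\<^sub>m ((d - 1) * k)"]) simp
  qed
  then obtain Q where Q: "Q \<in> carrier_mat ((d - 1) * k) ((d - 1) * k)" "fiedler Co k d i = bd1 Q" by blast
  then show ?thesis using car
    by (simp add: M_eq bdiag_two bdiag_one bdiag_mult mat_one_zero_dim)
qed

lemma M_commute: "d - 1 \<notin> set zs \<Longrightarrow> M * bd1 (G zs) = bd1 (G zs) * M"
proof (induction zs)
  case (Cons i zs)
  then have i: "M * bd1 (fiedler Co k d i) = bd1 (fiedler Co k d i) * M" by (intro M_commute1) auto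
  have *: "bd1 (G (i # zs)) = bd1 (fiedler Co k d i) * bd1 (G zs)"
    by (simp add: fprod_Cons bdiag_mult mat_one_zero_dim)
  have "M * (bd1 (fiedler Co k d i) * bd1 (G zs)) = bd1 (fiedler Co k d i) * (M * bd1 (G zs))"
    by (simp add: i mat_mult_assoc_dim[symmetric])
  also have "\<dots> = bd1 (fiedler Co k d i) * bd1 (G zs) * M"
    using Cons by (simp add: mat_mult_assoc_dim)
  finally show ?case by (simp only: *)
qed (simp add: fprod_Nil bdiag_one mat_one_zero_dim)

text \<open>For \<open>d\<close> at least 2 there are at least three blocks, so the last one lies
  outside the two on which \<open>M\<close> acts.\<close>

lemma M_proj:
  assumes "d \<noteq> 1"
  shows "M * bd0 (proj_last k d) = bd0 (proj_last k d)" "bd0 (proj_last k d) * M = bd0 (proj_last k d)"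
proof -
  have car: "Co d \<in> carrier_mat k k" using Co by simp
  have e: "d - 1 \<ge> 1" using assms d by linarith
  from proj_last_Suc[OF this] have *: "proj_last k d = bd0 (proj_last k (d - 1))" using d by simp
  show "M * bd0 (proj_last k d) = bd0 (proj_last k d)" "bd0 (proj_last k d) * M = bd0 (proj_last k d)"
    using car e
    unfolding * M_eq bdiag_two bdiag_zero by (simp_all add: bdiag_mult mat_one_zero_dim)
qed

text \<open>\<open>M\<close> commutes with all factors from \<open>a\<close> and thus reaches the
  left end.\<close>

lemma fprod_split_left: "F (a @ d # b) = M * bd1 (G (a @ d # b))" if "d - 1 \<notin> set a" "d \<notin> set a" "d \<notin> set b"
proof -
  have "F (a @ d # b) = bd1 (G a) * M * bd1 (G b)"
    using that by (simp add: fprod_append[OF d1 Co1] fprod_Cons fprod_Suc mat_mult_assoc_dim)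
  also have "\<dots> = M * (bd1 (G a) * bd1 (G b))"
    by (simp add: M_commute[OF that(1), symmetric] mat_mult_assoc_dim)
  finally show ?thesis by (simp add: fprod_diag bdiag_mult mat_one_zero_dim)
qed

lemma fprod_split_right: "F (a @ d # b) = bd1 (G (a @ d # b)) * M" if "d - 1 \<notin> set b" "d \<notin> set a" "d \<notin> set b"
proof -
  have "F (a @ d # b) = bd1 (G a) * (M * bd1 (G b))"
    using that by (simp add: fprod_append[OF d1 Co1] fprod_Cons fprod_Suc)
  also have "\<dots> = (bd1 (G a) * bd1 (G b)) * M"
    by (simp add: M_commute[OF that(1)] mat_mult_assoc_dim)
  finally show ?thesis by (simp add: fprod_diag bdiag_mult mat_one_zero_dim)
qed

lemma bd0_mult: "bd0 (G zs * proj_last k d) = bd1 (G zs) * bd0 (proj_last k d)"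
  "bd0 (proj_last k d * G zs) = bd0 (proj_last k d) * bd1 (G zs)"
  by (simp_all add: bdiag_mult mat_one_zero_dim)

text \<open>\<open>M\<close> fails to commute only with \<open>fiedler Co k (Suc d) (d - 1)\<close>, so it can be moved to whichever end of
  the product lies on its own side of that factor. If it thereby crosses the factor of index 0, then
  \<open>d \<noteq> 1\<close> and \<open>M\<close> fixes the last block, so the two outer identities are unaffected.\<close>

lemma fprod_peel:
  assumes dist: "distinct (L @ 0 # R)" and mem: "d \<in> set (L @ 0 # R)"
  shows "(F (L @ 0 # R) = M * bd1 (G (L @ 0 # R)) \<and>
      F L * proj_last k (Suc d) = M * bd0 (G L * proj_last k d) \<and>
      proj_last k (Suc d) * F R = bd0 (proj_last k d * G R)) \<or>
    (F (L @ 0 # R) = bd1 (G (L @ 0 # R)) * M \<and>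
      F L * proj_last k (Suc d) = bd0 (G L * proj_last k d) \<and>
      proj_last k (Suc d) * F R = bd0 (proj_last k d * G R) * M)"
proof -
  note proj = proj_last_Suc[OF d]
  consider (L) a b where "L = a @ d # b" | (R) a b where "R = a @ d # b"
    using mem d by (auto simp: in_set_conv_decomp)
  then show ?thesis
  proof cases
    case L
    then have nin: "d \<notin> set a" "d \<notin> set b" "d \<notin> set R" using dist d by auto
    show ?thesis
    proof (cases "d - 1 \<in> set a")
      case False
      have "F L = M * bd1 (G L)" unfolding L by (rule fprod_split_left) (use False nin in auto)
      moreover have "F (L @ 0 # R) = M * bd1 (G (L @ 0 # R))"
        using fprod_split_left[of a "b @ 0 # R"] False nin d L by auto
      moreover have "F R = bd1 (G R)" using nin by (intro fprod_Suc)
      ultimately show ?thesis by (simp add: proj bd0_mult mat_mult_assoc_dim)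
    next
      case True
      \<comment> \<open>By distinctness \<open>d - 1\<close> occurs only in \<open>a\<close>, so
        \<open>M\<close> can cross everything to its right. Since 0 does not occur in
        \<open>L\<close>, \<open>d - 1\<close> is not 0.\<close>
      then have nin': "d - 1 \<notin> set b" "d - 1 \<notin> set R" "d \<noteq> 1" using dist d L by (auto simp: le_Suc_eq)
      then have nin'': "d - 1 \<noteq> 0" using d by simp
      have FL: "F L = bd1 (G L) * M" unfolding L by (rule fprod_split_right) (use nin' nin in auto)
      have "F (L @ 0 # R) = bd1 (G (L @ 0 # R)) * M"
        using fprod_split_right[of "b @ 0 # R" a] nin nin' nin'' d L by auto
      moreover have "F L * proj_last k (Suc d) = bd0 (G L * proj_last k d)"
        by (simp add: FL proj bd0_mult mat_mult_assoc_dim M_proj[OF nin'(3)])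
      moreover have "proj_last k (Suc d) * F R = bd0 (proj_last k d * G R) * M"
        using nin by (simp add: proj fprod_Suc bd0_mult mat_mult_assoc_dim M_commute[OF nin'(2), symmetric])
          (simp add: mat_mult_assoc_dim[symmetric] M_proj[OF nin'(3)])
      ultimately show ?thesis by blast
    qed
  next
    case R
    then have nin: "d \<notin> set a" "d \<notin> set b" "d \<notin> set L" using dist d by auto
    show ?thesis
    proof (cases "d - 1 \<in> set b")
      case False
      have "F R = bd1 (G R) * M" unfolding R by (rule fprod_split_right) (use False nin in auto)
      moreover have "F (L @ 0 # R) = bd1 (G (L @ 0 # R)) * M"
        using fprod_split_right[of b "L @ 0 # a"] False nin d R by auto
      moreover have "F L = bd1 (G L)" using nin by (intro fprod_Suc)
      ultimately show ?thesis by (simp add: proj bd0_mult mat_mult_assoc_dim[symmetric])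
    next
      case True
      \<comment> \<open>Now \<open>d - 1\<close> stands to the right of \<open>M\<close>, which can
        cross \<open>a\<close>, the index 0 and \<open>L\<close> on its way to the left end.\<close>
      then have nin': "d - 1 \<notin> set a" "d - 1 \<notin> set L" "d \<noteq> 1" using dist d R by (auto simp: le_Suc_eq)
      then have nin'': "d - 1 \<noteq> 0" using d by simp
      have FR: "F R = M * bd1 (G R)" unfolding R by (rule fprod_split_left) (use nin' nin in auto)
      have "F (L @ 0 # R) = M * bd1 (G (L @ 0 # R))"
        using fprod_split_left[of "L @ 0 # a" b] nin nin' nin'' d R by auto
      moreover have "F L * proj_last k (Suc d) = M * bd0 (G L * proj_last k d)"
        using nin by (simp add: proj fprod_Suc bd0_mult mat_mult_assoc_dim[symmetric] M_commute[OF nin'(2)])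
          (simp add: mat_mult_assoc_dim M_proj[OF nin'(3)])
      moreover have "proj_last k (Suc d) * F R = bd0 (proj_last k d * G R)"
        by (simp add: FR proj bd0_mult mat_mult_assoc_dim[symmetric] M_proj[OF nin'(3)])
      ultimately show ?thesis by blast
    qed
  qed
qed

end

section \<open>The Fiedler pencil of a single matrix polynomial\<close>

interpretation cpoly: comm_ring_hom "\<lambda>x::complex. [:x:]"
  by unfold_locales (auto simp flip: one_pCons)

lemma cpoly_dims [simp]: "dim_row (cpoly_mat X) = dim_row X" "dim_col (cpoly_mat X) = dim_col X"
  by (auto simp: cpoly_mat_def)

lemma cpoly_mult: "dim_col X = dim_row Y \<Longrightarrow> cpoly_mat (X * Y) = cpoly_mat X * cpoly_mat Y"
  unfolding cpoly_mat_def by (rule cpoly.mat_hom_mult) auto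

lemma cpoly_bdiag: "cpoly_mat (bdiag X Y) = bdiag (cpoly_mat X) (cpoly_mat Y)"
  by (simp add: cpoly_mat_def map_mat_bdiag)

lemma cpoly_simps [simp]:
  "cpoly_mat (1\<^sub>m a) = 1\<^sub>m a" "cpoly_mat (0\<^sub>m a b) = 0\<^sub>m a b" "cpoly_mat (- X) = - cpoly_mat X"
  by (rule eq_matI; auto simp: cpoly_mat_def simp flip: one_pCons)+

lemma cpoly_proj_last: "cpoly_mat (proj_last k d) = proj_last k d"
  by (simp add: proj_last_def cpoly_bdiag)

text \<open>The first block column and the first block row of the identity, as degenerate \<open>2 \<times> 2\<close> block
  matrices with a block of width or height 0.\<close>

definition incl :: "nat \<Rightarrow> nat \<Rightarrow> 'a::{zero,one} mat" where
  "incl k b = four_block_mat (1\<^sub>m k) (0\<^sub>m k 0) (0\<^sub>m b k) (0\<^sub>m b 0)"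

definition restr :: "nat \<Rightarrow> nat \<Rightarrow> 'a::{zero,one} mat" where
  "restr k b = four_block_mat (1\<^sub>m k) (0\<^sub>m k b) (0\<^sub>m 0 k) (0\<^sub>m 0 b)"

lemma incl_restr_carrier: "incl k b \<in> carrier_mat (k + b) k" "restr k b \<in> carrier_mat k (k + b)"
  by (auto simp: incl_def restr_def intro!: carrier_matI)

text \<open>These are the relations that the reduction step requires of \<open>E\<close>,
  \<open>Et\<close> and \<open>J\<close>; the last fact identifies the leading matrix left over by
  that step.\<close>

lemma incl_restr:
  fixes k b :: nat and Y :: "'a::comm_ring_1 mat"
  defines "J \<equiv> bdiag (0\<^sub>m k k) (1\<^sub>m b) :: 'a mat"
  shows "J \<in> carrier_mat (k + b) (k + b)"
    "restr k b * incl k b = (1\<^sub>m k :: 'a mat)" "restr k b * J = 0\<^sub>m k (k + b)" "J * incl k b = 0\<^sub>m (k + b) k"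
    "J * J = J" "incl k b * restr k b = 1\<^sub>m (k + b) - J"
    "Y \<in> carrier_mat k k \<Longrightarrow> incl k b * (Y * restr k b) + J = bdiag Y (1\<^sub>m b)"
proof -
  note [simp del] = index_mult_mat(1)
  show "J \<in> carrier_mat (k + b) (k + b)" by (auto simp: J_def bdiag_def)
  show "restr k b * incl k b = (1\<^sub>m k :: 'a mat)"
    unfolding restr_def incl_def by (rule eq_matI) (simp_all add: mat_dim_simps)
  show "restr k b * J = 0\<^sub>m k (k + b)"
    unfolding restr_def J_def bdiag_def by (rule eq_matI) (simp_all add: mat_dim_simps)
  show "J * incl k b = 0\<^sub>m (k + b) k"
    unfolding incl_def J_def bdiag_def by (rule eq_matI) (simp_all add: mat_dim_simps)
  show "J * J = J"
    unfolding J_def by (simp add: bdiag_mult mat_one_zero_dim)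
  show "incl k b * restr k b = 1\<^sub>m (k + b) - J"
    unfolding incl_def restr_def J_def bdiag_def by (rule eq_matI) (auto simp add: mat_dim_simps)
  assume Y: "Y \<in> carrier_mat k k"
  \<comment> \<open>Padding \<open>Y\<close> with empty blocks makes the rule for block products
    applicable.\<close>
  then have Y_split: "four_block_mat Y (0\<^sub>m k 0) (0\<^sub>m 0 k) (0\<^sub>m 0 0) = Y" by (intro eq_matI) auto
  have "incl k b * (four_block_mat Y (0\<^sub>m k 0) (0\<^sub>m 0 k) (0\<^sub>m 0 0) * restr k b)
      = four_block_mat Y (0\<^sub>m k b) (0\<^sub>m b k) (0\<^sub>m b b)"
    unfolding incl_def restr_def using Y by (intro eq_matI) (auto simp add: mat_dim_simps)
  then have "incl k b * (Y * restr k b) = four_block_mat Y (0\<^sub>m k b) (0\<^sub>m b k) (0\<^sub>m b b)"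
    unfolding Y_split .
  then show "incl k b * (Y * restr k b) + J = bdiag Y (1\<^sub>m b)"
    using Y by (intro eq_matI) (auto simp: J_def bdiag_def)
qed

lemma less_sum3_cases:
  fixes i a b c :: nat
  assumes "i < a + (b + c)"
  obtains "i < a" | i' where "i = a + i'" "i' < b" | i' where "i = a + (b + i')" "i' < c"
proof -
  consider "i < a" | "a \<le> i" "i < a + b" | "a + b \<le> i" by linarith
  then show thesis
    using that(1) that(2)[of "i - a"] that(3)[of "i - a - b"] assms by cases auto
qed

text \<open>Passes from the partition 2k + b, in which Fiedler matrices are defined, to the
  partition k + (k + b) used by the reduction step.\<close>

lemma bdiag_swap_eq_incl:
  assumes [simp]: "dim_row X = k" "dim_col X = k"
  shows "bdiag (four_block_mat X (1\<^sub>m k) (1\<^sub>m k) (0\<^sub>m k k)) (1\<^sub>m b)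
   = four_block_mat X (restr k b) (incl k b) (bdiag (0\<^sub>m k k) (1\<^sub>m b))"
proof (rule eq_matI, goal_cases)
  case (1 i j)
  then have i: "i < k + (k + b)" and j: "j < k + (k + b)" by (simp_all add: incl_def restr_def)
  from i show ?case
    by (cases rule: less_sum3_cases; use j in \<open>cases rule: less_sum3_cases\<close>)
      (simp_all add: bdiag_def incl_def restr_def)
qed (simp_all add: incl_def restr_def)

lemma cpoly_four_block:
  "dim_row B = dim_row A \<Longrightarrow> dim_col C = dim_col A \<Longrightarrow> dim_row C = dim_row D \<Longrightarrow> dim_col B = dim_col D \<Longrightarrow>
   cpoly_mat (four_block_mat A B C D) = four_block_mat (cpoly_mat A) (cpoly_mat B) (cpoly_mat C) (cpoly_mat D)"
  unfolding cpoly_mat_def by (rule map_four_block_mat) auto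

lemma cpoly_fiedler:
  assumes "d \<ge> 1" "Co d \<in> carrier_mat k k"
  shows "cpoly_mat (fiedler Co k (Suc d) d) =
    four_block_mat (- cpoly_mat (Co d)) (restr k ((d - 1) * k)) (incl k ((d - 1) * k))
      (bdiag (0\<^sub>m k k) (1\<^sub>m ((d - 1) * k)))"
proof -
  define b where "b = (d - 1) * k"
  have "fiedler Co k (Suc d) d = bdiag (four_block_mat (- Co d) (1\<^sub>m k) (1\<^sub>m k) (0\<^sub>m k k)) (1\<^sub>m b)"
    using assms by (simp add: fiedler_def bdiag_empty b_def)
  then have "cpoly_mat (fiedler Co k (Suc d) d) =
    bdiag (four_block_mat (- cpoly_mat (Co d)) (1\<^sub>m k) (1\<^sub>m k) (0\<^sub>m k k)) (1\<^sub>m b)"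
    using assms by (simp add: cpoly_bdiag cpoly_four_block)
  also have "\<dots> = four_block_mat (- cpoly_mat (Co d)) (restr k b) (incl k b) (bdiag (0\<^sub>m k k) (1\<^sub>m b))"
    using assms(2) by (intro bdiag_swap_eq_incl) auto
  finally show ?thesis by (simp add: b_def)
qed

text \<open>The polynomial linearized by the pencil whose leading block is an arbitrary polynomial matrix \<open>X\<close>
  instead of \<open>\<lambda> A\<^sub>d\<close>.\<close>

definition partial_poly :: "(nat \<Rightarrow> complex mat) \<Rightarrow> nat \<Rightarrow> nat \<Rightarrow> complex poly mat \<Rightarrow> complex poly mat" where
  "partial_poly Co k d X = mat k k (\<lambda>(i,j). monom 1 (d - 1) * X $$ (i,j) + (\<Sum>l<d. monom (Co l $$ (i,j)) l))"

lemma partial_poly_dims [simp]: "dim_row (partial_poly Co k d X) = k" "dim_col (partial_poly Co k d X) = k"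
  by (simp_all add: partial_poly_def)

text \<open>One Horner step: \<lambda>^d X + \<lambda>^d A_d equals \<lambda>^(d-1) times \<lambda>
  (X + A_d).\<close>

lemma partial_poly_Suc:
  assumes "d \<ge> 1" "Co d \<in> carrier_mat k k" "X \<in> carrier_mat k k"
  shows "partial_poly Co k (Suc d) X = partial_poly Co k d (monom 1 1 \<cdot>\<^sub>m (X + cpoly_mat (Co d)))"
proof -
  obtain e where d: "d = Suc e" using assms by (cases d) auto
  then have e: "d - Suc 0 = e" by simp
  have 1: "monom 1 d = monom 1 e * (monom 1 1 :: complex poly)" by (simp add: mult_monom d)
  have 2: "monom c d = monom 1 e * (monom 1 1 * [:c:])" for c :: complex
    unfolding monom_0[symmetric] mult_monom d by simp
  have 3: "monom 1 d * x + (s + monom c d) = monom 1 e * (monom 1 1 * (x + [:c:])) + s" for x s and c :: complex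
    unfolding 1 2[of c] by (simp only: distrib_left mult.assoc add.assoc add.left_commute add.commute)
  show ?thesis
  proof (rule eq_matI, goal_cases)
    case (1 i j)
    let ?s = "\<Sum>l<d. monom (Co l $$ (i,j)) l"
    from 1 have ij: "i < k" "j < k" by auto
    then have "partial_poly Co k (Suc d) X $$ (i,j) = monom 1 d * X $$ (i,j) + (?s + monom (Co d $$ (i,j)) d)"
      by (simp add: partial_poly_def)
    also note 3
    also have "monom 1 e * (monom 1 1 * (X $$ (i,j) + [:Co d $$ (i,j):])) + ?s
        = partial_poly Co k d (monom 1 1 \<cdot>\<^sub>m (X + cpoly_mat (Co d))) $$ (i,j)"
      using ij assms(2,3) by (simp add: partial_poly_def cpoly_mat_def e)
    finally show ?case .
  qed auto
qed

lemma unimodular_shear: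
  shows "Z \<in> carrier_mat k N \<Longrightarrow> unimodular (k + N) (four_block_mat (1\<^sub>m k) Z (0\<^sub>m N k) (1\<^sub>m N))"
    and "Z \<in> carrier_mat N k \<Longrightarrow> unimodular (k + N) (four_block_mat (1\<^sub>m k) (0\<^sub>m k N) Z (1\<^sub>m N))"
  by (rule unimodular_if_inverse(1)[OF _ _ shear_inverse(1)], simp_all)
    (rule unimodular_if_inverse(1)[OF _ _ shear_inverse(2)], simp_all)

text \<open>The leading block \<open>X\<close> is arbitrary because a reduction step replaces it by
  its Horner successor, which need not be \<lambda> times a constant matrix. The list may contain
  indices beyond the degree, so \<open>L\<close> and \<open>R\<close> stay fixed throughout the
  induction.\<close>

lemma single_system:
  fixes Co :: "nat \<Rightarrow> complex mat" and X :: "complex poly mat"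
  assumes "d \<ge> 1" "\<forall>j<d. Co j \<in> carrier_mat k k" "X \<in> carrier_mat k k"
    and dist: "distinct (L @ 0 # R)" and "{0..<d} \<subseteq> set (L @ 0 # R)"
  shows "\<exists>U V. unimodular (d * k) U \<and> unimodular (d * k) V \<and>
    U * (bdiag X (monom 1 1 \<cdot>\<^sub>m 1\<^sub>m ((d - 1) * k)) - cpoly_mat (fprod Co k d (L @ 0 # R))) * V
      = bdiag (- 1\<^sub>m ((d - 1) * k)) (partial_poly Co k d X) \<and>
    U * cpoly_mat (fprod Co k d L * proj_last k d) = proj_last k d \<and>
    cpoly_mat (proj_last k d * fprod Co k d R) * V = proj_last k d"
  using assms(1,2,3,5)
proof (induction d arbitrary: X rule: nat_induct_at_least)
  case base
  \<comment> \<open>In degree 1 all factors of nonzero index are identities.\<close>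
  have one: "zs = [] \<or> 0 \<notin> set zs \<Longrightarrow> fprod Co k 1 zs = 1\<^sub>m k" for zs
    by (induction zs) (auto simp: fprod_Nil fprod_Cons fiedler_def mat_one_zero_dim)
  have car: "Co 0 \<in> carrier_mat k k" using base by simp
  have LR: "0 \<notin> set L" "0 \<notin> set R" using dist by auto
  have "fprod Co k 1 (L @ 0 # R) = - Co 0"
    using base car LR by (simp add: fprod_append fprod_Cons one[simplified]) (simp add: fiedler_def bdiag_empty mat_one_zero_dim)
  moreover have "proj_last k 1 = (1\<^sub>m k :: 'b::{zero,one} mat)" by (simp add: proj_last_def bdiag_empty)
  \<comment> \<open>The blocks of size 0 disappear and both sides are X + A_0; hence identity
    transformations suffice.\<close>
  moreover have "bdiag X (monom 1 1 \<cdot>\<^sub>m 1\<^sub>m 0) + cpoly_mat (Co 0) = bdiag (- 1\<^sub>m 0) (partial_poly Co k 1 X)"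
    using base car by (intro eq_matI) (auto simp: bdiag_def partial_poly_def cpoly_mat_def monom_0)
  moreover have "bdiag X (monom 1 1 \<cdot>\<^sub>m 1\<^sub>m 0) - (- cpoly_mat (Co 0)) = bdiag X (monom 1 1 \<cdot>\<^sub>m 1\<^sub>m 0) + cpoly_mat (Co 0)"
    using base car by (intro eq_matI) auto
  ultimately show ?case using base car LR one
    by (intro exI[of _ "1\<^sub>m (1 * k)"]) (simp add: unimodular_one mat_one_zero_dim cpoly_proj_last)
next
  case (Suc d)
  define b where "b = (d - 1) * k"
  define E Et J where "E = (incl k b :: complex poly mat)" and "Et = (restr k b :: complex poly mat)"
    and "J = (bdiag (0\<^sub>m k k) (1\<^sub>m b) :: complex poly mat)"
  define t where "t = (monom 1 1 :: complex poly)"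
  define A where "A = cpoly_mat (Co d)"
  define Y where "Y = X + A"
  have N: "k + b = d * k" using Suc.hyps by (cases d) (auto simp: b_def)
  have Cod: "Co d \<in> carrier_mat k k" and Co: "\<forall>j\<le>d. Co j \<in> carrier_mat k k" and Co': "\<forall>j<d. Co j \<in> carrier_mat k k"
    and Co1: "\<forall>j<Suc d. Co j \<in> carrier_mat k k"
    using Suc.prems by auto
  have A: "A \<in> carrier_mat k k" using Cod by (auto simp: A_def)
  have X: "X \<in> carrier_mat k k" by fact
  have Y: "Y \<in> carrier_mat k k" "dim_row Y = k" "dim_col Y = k" using A X by (auto simp: Y_def)
  have mem: "d \<in> set (L @ 0 # R)" using Suc.prems(3) by auto
  \<comment> \<open>The induction hypothesis is applied to the Horner successor \<open>t\<close>
    times \<open>Y\<close>.\<close>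
  obtain U' V' where U'V': "unimodular (d * k) U'" "unimodular (d * k) V'"
    "U' * (bdiag (t \<cdot>\<^sub>m Y) (t \<cdot>\<^sub>m 1\<^sub>m b) - cpoly_mat (fprod Co k d (L @ 0 # R))) * V'
      = bdiag (- 1\<^sub>m b) (partial_poly Co k d (t \<cdot>\<^sub>m Y))"
    "U' * cpoly_mat (fprod Co k d L * proj_last k d) = proj_last k d"
    "cpoly_mat (proj_last k d * fprod Co k d R) * V' = proj_last k d"
  proof -
    have "{0..<d} \<subseteq> set (L @ 0 # R)" by (rule order_trans[OF _ Suc.prems(3)]) auto
    from Suc.IH[OF Co' _ this, of "t \<cdot>\<^sub>m Y"] Y(1) that show thesis
      unfolding b_def[symmetric] t_def[symmetric] by (metis smult_carrier_mat)
  qed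
  define W where "W = cpoly_mat (fprod Co k d (L @ 0 # R))"
  define l where "l = cpoly_mat (fprod Co k d L * proj_last k d)"
  define r where "r = cpoly_mat (proj_last k d * fprod Co k d R)"
  note fc = fprod_carrier[OF Suc.hyps Co']
  have dims: "U' \<in> carrier_mat (d * k) (d * k)" "V' \<in> carrier_mat (d * k) (d * k)"
    "W \<in> carrier_mat (d * k) (d * k)" "l \<in> carrier_mat (d * k) (d * k)" "r \<in> carrier_mat (d * k) (d * k)"
    using U'V' fc[THEN carrier_matD(1)] fc[THEN carrier_matD(2)] Suc.hyps
    by (auto simp: unimodular_def W_def l_def r_def intro!: carrier_matI)
  note EJ = incl_restr(1-6)[where 'a="complex poly" and k=k and b=b, folded E_def Et_def J_def, unfolded N]
  have EEt: "E \<in> carrier_mat (d * k) k" "Et \<in> carrier_mat k (d * k)"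
    unfolding E_def Et_def N[symmetric] by (rule incl_restr_carrier)+
  \<comment> \<open>The gap is the place of the inner matrix, filled below by \<open>W\<close>,
    \<open>l\<close> or \<open>r\<close>.\<close>
  note ctx = X A EEt EJ(1) _ EJ(2-6)
  have EYE: "E * (Y * Et) + J = bdiag Y (1\<^sub>m b)"
    unfolding E_def Et_def J_def by (rule incl_restr(7)[OF Y(1)])
  have lead: "bdiag (t \<cdot>\<^sub>m Y) (t \<cdot>\<^sub>m 1\<^sub>m b) = t \<cdot>\<^sub>m (E * (Y * Et) + J)"
    unfolding EYE by (rule eq_matI) (auto simp: bdiag_def)
  \<comment> \<open>\<open>S\<close> is the modified swap of the reduction step; \<open>F1\<close>
    shears columns when \<open>M\<close> stands on the left, and \<open>F2\<close> shears rows when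
    it stands on the right.\<close>
  define S where "S = four_block_mat (0\<^sub>m k k) Et E (J + E * (Y * Et))"
  define F1 where "F1 = four_block_mat (1\<^sub>m k) (t \<cdot>\<^sub>m Et) (0\<^sub>m (d * k) k) (1\<^sub>m (d * k))"
  define F2 where "F2 = four_block_mat (1\<^sub>m k) (0\<^sub>m k (d * k)) (t \<cdot>\<^sub>m E) (1\<^sub>m (d * k))"
  have carS: "S \<in> carrier_mat (k + d * k) (k + d * k)" "F1 \<in> carrier_mat (k + d * k) (k + d * k)"
     "F2 \<in> carrier_mat (k + d * k) (k + d * k)"
    using EEt EJ(1) Y by (auto simp: S_def F1_def F2_def intro!: carrier_matI)
  have uF1: "unimodular (Suc d * k) F1"
    using unimodular_shear(1)[of "t \<cdot>\<^sub>m Et" k "d * k"] EEt by (simp add: F1_def)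
  have uF2: "unimodular (Suc d * k) F2"
    using unimodular_shear(2)[of "t \<cdot>\<^sub>m E" "d * k" k] EEt by (simp add: F2_def)
  have uS: "unimodular (Suc d * k) S"
    unfolding S_def step_factorization[OF ctx Y(2,3), OF dims(3)]
  proof (rule unimodular_mult)
    show "unimodular (Suc d * k) (four_block_mat (0\<^sub>m k k) Et E J)"
      using unimodular_if_inverse(1)[OF _ _ swap_involution[OF ctx, OF dims(3)]] EEt EJ(1) by simp
    show "unimodular (Suc d * k) (four_block_mat (1\<^sub>m k) (Y * Et) (0\<^sub>m (d * k) k) (1\<^sub>m (d * k)))"
      using unimodular_shear(1)[of "Y * Et" k "d * k"] EEt Y by simp
  qed
  have bd: "unimodular (Suc d * k) (bdiag (1\<^sub>m k) U')" "unimodular (Suc d * k) (bdiag (1\<^sub>m k) V')"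
    using unimodular_bdiag[OF unimodular_one U'V'(1)] unimodular_bdiag[OF unimodular_one U'V'(2)] by auto
  \<comment> \<open>The new block -I joins those split off in lower degree.\<close>
  have core: "bdiag (1\<^sub>m k) U' * bdiag (- 1\<^sub>m k) (t \<cdot>\<^sub>m (E * (Y * Et) + J) - W) * bdiag (1\<^sub>m k) V'
      = bdiag (- 1\<^sub>m (d * k)) (partial_poly Co k (Suc d) X)"
  proof -
    have "bdiag (1\<^sub>m k) U' * bdiag (- 1\<^sub>m k) (t \<cdot>\<^sub>m (E * (Y * Et) + J) - W) * bdiag (1\<^sub>m k) V'
      = bdiag (- 1\<^sub>m k) (U' * (t \<cdot>\<^sub>m (E * (Y * Et) + J) - W) * V')"
      using dims by (simp add: bdiag_mult mat_one_zero_dim)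
    also have "\<dots> = bdiag (bdiag (- 1\<^sub>m k) (- 1\<^sub>m b)) (partial_poly Co k d (t \<cdot>\<^sub>m Y))"
      using U'V'(3) unfolding lead W_def bdiag_assoc by simp
    also have "partial_poly Co k d (t \<cdot>\<^sub>m Y) = partial_poly Co k (Suc d) X"
      unfolding t_def Y_def A_def by (rule partial_poly_Suc[of d Co, symmetric]) (use Suc.hyps Cod X in auto)
    finally show ?thesis by (simp add: bdiag_uminus bdiag_one N)
  qed
  have corel: "bdiag (1\<^sub>m k) U' * bdiag (0\<^sub>m k k) l = proj_last k (Suc d)"
    and corer: "bdiag (0\<^sub>m k k) r * bdiag (1\<^sub>m k) V' = proj_last k (Suc d)"
    using dims U'V'(4,5)[folded l_def r_def] Suc.hyps by (simp_all add: bdiag_mult mat_one_zero_dim proj_last_Suc)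
  define P where "P = bdiag X (t \<cdot>\<^sub>m 1\<^sub>m (d * k))"
  define M where "M = four_block_mat (- A) Et E J"
  have M: "cpoly_mat (fiedler Co k (Suc d) d) = M"
    unfolding M_def A_def E_def Et_def J_def b_def by (rule cpoly_fiedler[of d Co, OF Suc.hyps Cod])
  have carM: "M \<in> carrier_mat (k + d * k) (k + d * k)" "P \<in> carrier_mat (k + d * k) (k + d * k)"
    using EEt EJ(1) A X by (auto simp: M_def P_def intro!: carrier_matI)
  have fd: "dim_row (fiedler Co k (Suc d) d) = k + d * k" "dim_col (fiedler Co k (Suc d) d) = k + d * k"
    using fiedler_carrier[of "Suc d" Co k d] Co1 by auto
  have gd: "dim_row (fprod Co k d zs) = d * k" "dim_col (fprod Co k d zs) = d * k" for zs
    using fc[of zs] by auto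
  let ?sys = "cpoly_mat (fprod Co k (Suc d) (L @ 0 # R))"
  let ?l = "cpoly_mat (fprod Co k (Suc d) L * proj_last k (Suc d))"
  let ?r = "cpoly_mat (proj_last k (Suc d) * fprod Co k (Suc d) R)"
  consider (left) "?sys = M * bdiag (1\<^sub>m k) W" "?l = M * bdiag (0\<^sub>m k k) l" "?r = bdiag (0\<^sub>m k k) r"
    | (right) "?sys = bdiag (1\<^sub>m k) W * M" "?l = bdiag (0\<^sub>m k k) l" "?r = bdiag (0\<^sub>m k k) r * M"
    using fprod_peel[OF Suc.hyps Co dist mem]
  proof (elim disjE conjE, goal_cases)
    case 1
    show ?case by (rule 1(1); unfold 1(3-) W_def l_def r_def)
       (use Suc.hyps in \<open>simp_all add: cpoly_mult cpoly_bdiag fd gd M\<close>)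
  next
    case 2
    show ?case by (rule 2(2); unfold 2(3-) W_def l_def r_def)
       (use Suc.hyps in \<open>simp_all add: cpoly_mult cpoly_bdiag fd gd M\<close>)
  qed
  then show ?case
  proof cases
    case left
    \<comment> \<open>The reduction step acts first, next to the pencil; the transformations of
      lower degree then act on the remaining \<open>d\<close> blocks.\<close>
    let ?U = "bdiag (1\<^sub>m k) U' * S" and ?V = "F1 * bdiag (1\<^sub>m k) V'"
    have "?U * (P - ?sys) * ?V = bdiag (1\<^sub>m k) U' * (S * ((P - M * bdiag (1\<^sub>m k) W) * F1)) * bdiag (1\<^sub>m k) V'"
      unfolding left using dims carS carM by (simp add: mat_mult_assoc_dim)
    also have "S * ((P - M * bdiag (1\<^sub>m k) W) * F1) = bdiag (- 1\<^sub>m k) (t \<cdot>\<^sub>m (E * (Y * Et) + J) - W)"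
      unfolding S_def P_def M_def F1_def by (rule left_step[OF ctx Y_def, OF dims(3)])
    also note core
    finally have 1: "?U * (P - ?sys) * ?V = bdiag (- 1\<^sub>m (d * k)) (partial_poly Co k (Suc d) X)" .
    have "?U * ?l = bdiag (1\<^sub>m k) U' * (S * (M * bdiag (0\<^sub>m k k) l))"
      unfolding left using dims carS carM by (simp add: mat_mult_assoc_dim)
    also have "S * (M * bdiag (0\<^sub>m k k) l) = bdiag (0\<^sub>m k k) l"
      unfolding S_def M_def by (rule left_step_fix[OF ctx Y(2,3), OF dims(4)])
    also note corel
    finally have 2: "?U * ?l = proj_last k (Suc d)" .
    have "?r * ?V = (bdiag (0\<^sub>m k k) r * F1) * bdiag (1\<^sub>m k) V'"
      unfolding left using dims carS carM by (simp add: mat_mult_assoc_dim)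
    also have "bdiag (0\<^sub>m k k) r * F1 = bdiag (0\<^sub>m k k) r"
      unfolding F1_def by (rule shear_fix(1)[OF ctx, OF dims(5)])
    also note corer
    finally have 3: "?r * ?V = proj_last k (Suc d)" .
    show ?thesis using 1 2 3 unimodular_mult[OF bd(1) uS] unimodular_mult[OF uF1 bd(2)]
      unfolding P_def t_def diff_Suc_1 by blast
  next
    case right
    let ?U = "bdiag (1\<^sub>m k) U' * F2" and ?V = "S * bdiag (1\<^sub>m k) V'"
    have "?U * (P - ?sys) * ?V = bdiag (1\<^sub>m k) U' * (F2 * (P - bdiag (1\<^sub>m k) W * M) * S) * bdiag (1\<^sub>m k) V'"
      unfolding right using dims carS carM by (simp add: mat_mult_assoc_dim)
    also have "F2 * (P - bdiag (1\<^sub>m k) W * M) * S = bdiag (- 1\<^sub>m k) (t \<cdot>\<^sub>m (E * (Y * Et) + J) - W)"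
      unfolding S_def P_def M_def F2_def by (rule right_step[OF ctx Y_def, OF dims(3)])
    also note core
    finally have 1: "?U * (P - ?sys) * ?V = bdiag (- 1\<^sub>m (d * k)) (partial_poly Co k (Suc d) X)" .
    have "?U * ?l = bdiag (1\<^sub>m k) U' * (F2 * bdiag (0\<^sub>m k k) l)"
      unfolding right using dims carS carM by (simp add: mat_mult_assoc_dim)
    also have "F2 * bdiag (0\<^sub>m k k) l = bdiag (0\<^sub>m k k) l"
      unfolding F2_def by (rule shear_fix(2)[OF ctx, OF dims(4)])
    also note corel
    finally have 2: "?U * ?l = proj_last k (Suc d)" .
    have "?r * ?V = (bdiag (0\<^sub>m k k) r * M * S) * bdiag (1\<^sub>m k) V'"
      unfolding right using dims carS carM by (simp add: mat_mult_assoc_dim)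
    also have "bdiag (0\<^sub>m k k) r * M * S = bdiag (0\<^sub>m k k) r"
      unfolding S_def M_def by (rule right_step_fix[OF ctx Y(2,3), OF dims(5)])
    also note corer
    finally have 3: "?r * ?V = proj_last k (Suc d)" .
    show ?thesis using 1 2 3 unimodular_mult[OF bd(1) uF2] unimodular_mult[OF uS bd(2)]
      unfolding P_def t_def diff_Suc_1 by blast
  qed
qed

lemma cpoly_carrier [simp]: "cpoly_mat X \<in> carrier_mat a b \<longleftrightarrow> X \<in> carrier_mat a b"
  by (metis cpoly_dims carrier_matD carrier_matI)

section \<open>The Rosenbrock system\<close>

lemma lam_mat_eq: "lam_mat X = monom 1 1 \<cdot>\<^sub>m cpoly_mat X"
  by (rule eq_matI) (simp_all add: lam_mat_def cpoly_mat_def smult_monom)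

lemma lam_mat_fiedler_lead:
  "lam_mat (fiedler_lead Co k d) = bdiag (monom 1 1 \<cdot>\<^sub>m cpoly_mat (Co d)) (monom 1 1 \<cdot>\<^sub>m 1\<^sub>m ((d - 1) * k))"
  unfolding lam_mat_eq fiedler_lead_def cpoly_bdiag by (rule eq_matI) (auto simp: bdiag_def)

text \<open>The pencil of the given polynomial is the instance of \<open>single_system\<close> with
  leading block \<lambda> A_d.\<close>

lemma mat_poly_eq_partial_poly:
  assumes "d \<ge> 1" "Co d \<in> carrier_mat k k"
  shows "mat_poly k d Co = partial_poly Co k d (monom 1 1 \<cdot>\<^sub>m cpoly_mat (Co d))"
proof (rule eq_matI, goal_cases)
  case (1 i j)
  from assms(1) have d: "d - 1 + (1 + 0) = d" by simp
  have "monom 1 (d - 1) * (monom 1 1 * [:c:]) = monom c d" for c :: complex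
    unfolding monom_0[symmetric] mult_monom d by simp
  moreover have "(\<Sum>l\<le>d. g l) = g d + (\<Sum>l<d. g l)" for g :: "nat \<Rightarrow> complex poly"
    unfolding lessThan_Suc_atMost[symmetric] sum.lessThan_Suc by (rule add.commute)
  ultimately show ?case using 1 assms(2)
    by (simp add: mat_poly_def partial_poly_def cpoly_mat_def)
qed (simp_all add: mat_poly_def)

lemma fiedler_linearization:
  assumes "d \<ge> 1" "\<forall>j\<le>d. Co j \<in> carrier_mat k k"
    and "distinct (L @ 0 # R)" "{0..<d} \<subseteq> set (L @ 0 # R)"
  obtains U V where "unimodular (d * k) U" "unimodular (d * k) V"
    "U * (lam_mat (fiedler_lead Co k d) - cpoly_mat (fprod Co k d (L @ 0 # R))) * V
      = bdiag (- 1\<^sub>m ((d - 1) * k)) (mat_poly k d Co)"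
    "U * cpoly_mat (fprod Co k d L * proj_last k d) = proj_last k d"
    "cpoly_mat (proj_last k d * fprod Co k d R) * V = proj_last k d"
proof -
  have "\<forall>j<d. Co j \<in> carrier_mat k k" "monom 1 1 \<cdot>\<^sub>m cpoly_mat (Co d) \<in> carrier_mat k k"
    and Cod: "Co d \<in> carrier_mat k k"
    using assms(2) by auto
  from single_system[OF assms(1) this(1,2) assms(3,4)] that
  show thesis unfolding lam_mat_fiedler_lead mat_poly_eq_partial_poly[of d Co, OF assms(1) Cod] by blast
qed

section \<open>The coupling blocks\<close>

lemma pred_mult_add: "(p::nat) \<ge> 1 \<Longrightarrow> (p - 1) * n + n = p * n"
  by (cases p) auto

text \<open>The only nonzero entry of the left factor is in its last row and column, so
  \<open>X\<close> fills the lower right corner.\<close>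

lemma kron_ecol:
  fixes X :: "'a::comm_ring_1 mat"
  assumes "p \<ge> 1" "q \<ge> 1" "X \<in> carrier_mat n m"
  shows "kron (ecol p p * transpose_mat (ecol q q)) X =
    four_block_mat (0\<^sub>m ((p - 1) * n) ((q - 1) * m)) (0\<^sub>m ((p - 1) * n) m) (0\<^sub>m n ((q - 1) * m)) X"
proof -
  \<comment> \<open>An index below \<open>r * k\<close> lies in the last of \<open>r\<close> blocks
    exactly when its quotient by \<open>k\<close> is \<open>r - 1\<close>; its remainder is then the
    offset in that block.\<close>
  have div_mod: "(i div k = r - 1) = (\<not> i < (r - 1) * k)" "\<not> i < (r - 1) * k \<Longrightarrow> i mod k = i - (r - 1) * k"
    if "i < (r - 1) * k + k" for i k r :: nat
  proof -
    from that have k: "k > 0" by (cases k) auto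
    have *: "i div k < r - 1 + 1" using that by (simp add: less_mult_imp_div_less algebra_simps)
    have "i div k < r - 1 \<longleftrightarrow> i < (r - 1) * k" by (rule div_less_iff_less_mult[OF k])
    with * show "(i div k = r - 1) = (\<not> i < (r - 1) * k)" by linarith
    then show "\<not> i < (r - 1) * k \<Longrightarrow> i mod k = i - (r - 1) * k"
      by (metis minus_div_mult_eq_mod)
  qed
  have N: "p * n = (p - 1) * n + n" "q * m = (q - 1) * m + m"
    using assms(1,2) by (simp_all only: pred_mult_add)
  have ee: "(ecol p p * transpose_mat (ecol q q) :: 'a mat) $$ (r, s) = (if r = p - 1 \<and> s = q - 1 then 1 else 0)"
    if "r < p" "s < q" for r s
    using that by (simp add: ecol_def scalar_prod_def)
  have dims: "dim_row (ecol r r :: 'a mat) = r" for r by (simp add: ecol_def)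
  show ?thesis
  proof (rule eq_matI, goal_cases)
    case (1 i j)
    then have i: "i < (p - 1) * n + n" and j: "j < (q - 1) * m + m" using assms by auto
    then have "i < p * n" "j < q * m" by (simp_all only: N)
    moreover from this have "i div n < p" "j div m < q" by (simp_all add: less_mult_imp_div_less)
    ultimately have "kron (ecol p p * transpose_mat (ecol q q)) X $$ (i, j)
       = (if i div n = p - 1 \<and> j div m = q - 1 then X $$ (i mod n, j mod m) else 0)"
      using assms by (simp add: kron_def dims ee del: index_mult_mat(1))
    also have "\<dots> = (if i < (p - 1) * n \<or> j < (q - 1) * m then 0 else X $$ (i - (p - 1) * n, j - (q - 1) * m))"
      unfolding div_mod(1)[OF i] div_mod(1)[OF j] using div_mod(2)[OF i] div_mod(2)[OF j] by simp
    finally show ?case using i j assms by simp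
  qed (use assms(3) N in \<open>simp_all add: kron_def dims\<close>)
qed

text \<open>Allows the projections to be inserted around a coupling block, where the conditions on
  the transformations can absorb the outer factors.\<close>

lemma proj_last_corner:
  fixes n m p q :: nat and X :: "'a::comm_ring_1 mat"
  assumes "X \<in> carrier_mat n m"
  defines "Z \<equiv> four_block_mat (0\<^sub>m ((p - 1) * n) ((q - 1) * m)) (0\<^sub>m ((p - 1) * n) m) (0\<^sub>m n ((q - 1) * m)) X"
  shows "proj_last n p * Z * proj_last m q = Z"
  using assms(1) unfolding Z_def proj_last_def bdiag_def
  by (simp add: mat_dim_simps)

lemma bdiag_four_block_bdiag:
  fixes U :: "'a::comm_ring_1 mat"
  assumes "U \<in> carrier_mat a a" "U' \<in> carrier_mat b b" "V \<in> carrier_mat a a" "V' \<in> carrier_mat b b"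
    "P \<in> carrier_mat a a" "Q \<in> carrier_mat a b" "R \<in> carrier_mat b a" "S \<in> carrier_mat b b"
  shows "bdiag U U' * four_block_mat P Q R S * bdiag V V'
    = four_block_mat (U * P * V) (U * Q * V') (U' * R * V) (U' * S * V')"
  using assms unfolding bdiag_def
  by (simp add: mat_dim_simps)

section \<open>Signed permutations and the reordering of blocks\<close>

lemma unimodular_monomial:
  fixes f :: "nat \<Rightarrow> nat" and c :: "nat \<Rightarrow> complex poly"
  assumes inj: "inj_on f {0..<N}" and f: "\<And>i. i < N \<Longrightarrow> f i < N" and c: "\<And>i. i < N \<Longrightarrow> c i * c i = 1"
  shows "unimodular N (mat N N (\<lambda>(i,j). if j = f i then c i else 0))" (is "unimodular N ?P")
    and "unimodular N (mat N N (\<lambda>(i,j). if i = f j then c j else 0))" (is "unimodular N ?Q")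
proof -
  \<comment> \<open>\<open>?Q\<close> is the transpose of \<open>?P\<close>; it is the inverse
    because \<open>f\<close> is injective and each \<open>c i\<close> squares to 1.\<close>
  have "?P * ?Q = 1\<^sub>m N"
  proof (rule eq_matI, goal_cases)
    case (1 i j)
    then have ij: "i < N" "j < N" by auto
    then have "(?P * ?Q) $$ (i, j) = (\<Sum>l = 0..<N. (if l = f i then c i else 0) * (if l = f j then c j else 0))"
      by (simp add: scalar_prod_def)
    also have "\<dots> = (\<Sum>l = 0..<N. if l = f i then (if f i = f j then c i * c j else 0) else 0)"
      by (rule sum.cong) auto
    also have "\<dots> = (if f i = f j then c i * c j else 0)"
      using f[OF ij(1)] by simp
    also have "\<dots> = (if i = j then 1 else 0)"
      using inj ij c by (auto dest: inj_onD)
    finally show ?case using ij by simp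
  qed auto
  then show "unimodular N ?P" "unimodular N ?Q"
    by (auto intro: unimodular_if_inverse[of ?P N ?Q])
qed

lemma monomial_mult_index:
  fixes T :: "'a::comm_ring_1 mat"
  assumes T: "T \<in> carrier_mat N N" and f: "\<And>i. i < N \<Longrightarrow> f i < N" and ij: "i < N" "j < N"
  shows "(mat N N (\<lambda>(i,j). if j = f i then c i else 0) * T * mat N N (\<lambda>(i,j). if i = g j then c' j else 0)) $$ (i, j)
    = c i * (\<Sum>l = 0..<N. T $$ (f i, l) * (if l = g j then c' j else 0))"
proof -
  let ?P = "mat N N (\<lambda>(i,j). if j = f i then c i else 0)"
  have "(?P * T) $$ (i, l) = c i * T $$ (f i, l)" if "l < N" for l
  proof -
    have "(?P * T) $$ (i, l) = (\<Sum>h = 0..<N. (if h = f i then c i else 0) * T $$ (h, l))"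
      using T ij that by (simp add: scalar_prod_def)
    also have "\<dots> = (\<Sum>h = 0..<N. if h = f i then c i * T $$ (f i, l) else 0)"
      by (rule sum.cong) auto
    finally show ?thesis using f[OF ij(1)] by simp
  qed
  then show ?thesis using T ij
    by (simp add: scalar_prod_def sum_distrib_left mult.assoc)
qed

text \<open>The same permutation of rows and columns collects the two negative identities in front,
  and negating their rows makes them positive.\<close>

lemma rosenbrock_to_diag:
  fixes A D B C :: "complex poly mat" and a b n m :: nat
  assumes car: "A \<in> carrier_mat n n" "D \<in> carrier_mat m m" "B \<in> carrier_mat n m" "C \<in> carrier_mat m n"
  defines "T \<equiv> four_block_mat (bdiag (- 1\<^sub>m a) A)
      (four_block_mat (0\<^sub>m a b) (0\<^sub>m a m) (0\<^sub>m n b) B)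
      (four_block_mat (0\<^sub>m b a) (0\<^sub>m b n) (0\<^sub>m m a) C) (bdiag (- 1\<^sub>m b) D)"
    and "N \<equiv> (a + n) + (b + m)"
  obtains U V where "unimodular N U" "unimodular N V"
    "U * T * V = bdiag (1\<^sub>m a) (bdiag (1\<^sub>m b) (four_block_mat A B C D))"
proof -
  \<comment> \<open>\<open>f\<close> maps positions in the block order a, b, n, m to positions in
    the order a, n, b, m of \<open>T\<close>; \<open>c\<close> negates the first
    \<open>a + b\<close> rows.\<close>
  define f where "f i = (if i < a then i else if i < a + b then i + n else if i < a + b + n then i - b else i)" for i
  define c where "c i = (if i < a + b then -1 else 1 :: complex poly)" for i
  define U where "U = mat N N (\<lambda>(i,j). if j = f i then c i else 0)"
  define V where "V = mat N N (\<lambda>(i,j). if i = f j then 1 else (0::complex poly))"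
  have f: "i < N \<Longrightarrow> f i < N" for i unfolding f_def N_def by auto
  have inj: "inj_on f {0..<N}" by (rule inj_onI) (auto simp: f_def split: if_splits)
  have "unimodular N U" "unimodular N V"
    unfolding U_def V_def using unimodular_monomial[OF inj f, of c] unimodular_monomial[OF inj f, of "\<lambda>_. 1"]
    by (auto simp: c_def)
  moreover have "U * T * V = bdiag (1\<^sub>m a) (bdiag (1\<^sub>m b) (four_block_mat A B C D))"
  proof (rule eq_matI, goal_cases)
    case (1 i j)
    then have ij: "i < N" "j < N" using car by (auto simp: N_def)
    have T: "T \<in> carrier_mat N N" using car by (auto simp: T_def N_def bdiag_def intro!: carrier_matI)
    have "(U * T * V) $$ (i, j) = c i * (\<Sum>l = 0..<N. T $$ (f i, l) * (if l = f j then 1 else 0))"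
      unfolding U_def V_def by (rule monomial_mult_index[OF T f ij])
    also have "\<dots> = c i * (\<Sum>l = 0..<N. if l = f j then T $$ (f i, f j) else 0)"
      by (intro arg_cong2[where f="(*)"] sum.cong) auto
    also have "\<dots> = c i * T $$ (f i, f j)" using f[OF ij(2)] by simp
    finally have *: "(U * T * V) $$ (i, j) = c i * T $$ (f i, f j)" .
    \<comment> \<open>With indices written as explicit offsets, simplification can evaluate the
      nested block matrices in every case.\<close>
    have blocks: "i < a \<or> (\<exists>i'<b. i = a + i') \<or> (\<exists>i'<n. i = a + (b + i')) \<or> (\<exists>i'<m. i = a + (b + (n + i')))"
      if "i < N" for i
    proof -
      consider "i < a" | "a \<le> i" "i < a + b" | "a + b \<le> i" "i < a + b + n" | "a + b + n \<le> i" by linarith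
      then show ?thesis
      proof cases
        case 2
        then have "i - a < b" "i = a + (i - a)" by simp_all
        then show ?thesis by blast
      next
        case 3
        then have "i - a - b < n" "i = a + (b + (i - a - b))" by simp_all
        then show ?thesis by blast
      next
        case 4
        then have "i - a - b - n < m" "i = a + (b + (n + (i - a - b - n)))" using that by (simp_all add: N_def)
        then show ?thesis by blast
      qed simp
    qed
    show ?case unfolding * using blocks[OF ij(1)] blocks[OF ij(2)] car
      by (elim disjE exE conjE) (simp_all add: T_def bdiag_def c_def f_def)
  qed (use car in \<open>simp_all add: U_def V_def N_def\<close>)
  ultimately show thesis by (rule that)
qed

section \<open>Block form of the product of the system's Fiedler matrices\<close>

lemma foldr_sys_fiedler:
  assumes "0 \<notin> set zs" "dA \<ge> 1" "dD \<ge> 1" "\<forall>j<dA. Ac j \<in> carrier_mat n n" "\<forall>j<dD. Dc j \<in> carrier_mat m m"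
    and Z: "dim_row Z = dA * n + dD * m"
  shows "foldr (\<lambda>i P. sys_fiedler Ac Dc B C n m dA dD i * P) zs Z
    = bdiag (fprod Ac n dA zs) (fprod Dc m dD zs) * Z"
  using assms(1)
proof (induction zs)
  case Nil
  then show ?case using Z by (simp add: fprod_Nil bdiag_one mat_one_zero_dim)
next
  case (Cons i zs)
  note A = fiedler_carrier[OF assms(2,4), of i] fprod_carrier[OF assms(2,4), of zs]
  note D = fiedler_carrier[OF assms(3,5), of i] fprod_carrier[OF assms(3,5), of zs]
  have "foldr (\<lambda>i P. sys_fiedler Ac Dc B C n m dA dD i * P) (i # zs) Z
    = bdiag (fiedler Ac n dA i) (fiedler Dc m dD i) * (bdiag (fprod Ac n dA zs) (fprod Dc m dD zs) * Z)"
    using Cons by (simp add: sys_fiedler_def)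
  also have "\<dots> = bdiag (fprod Ac n dA (i # zs)) (fprod Dc m dD (i # zs)) * Z"
    using A D Z by (simp add: bdiag_mult fprod_Cons flip: mat_mult_assoc_dim)
  finally show ?case .
qed

lemma mat_minus_four_block:
  fixes P :: "'a::comm_ring_1 mat"
  assumes "P \<in> carrier_mat a a" "S \<in> carrier_mat b b" "P' \<in> carrier_mat a a" "Q \<in> carrier_mat a b"
    "R \<in> carrier_mat b a" "S' \<in> carrier_mat b b"
  shows "bdiag P S - four_block_mat P' Q R S' = four_block_mat (P - P') (- Q) (- R) (S - S')"
  using assms by (intro eq_matI) (auto simp: bdiag_def)

text \<open>Only the factor of index 0 couples the two systems; everything on either side of it
  multiplies to a block diagonal matrix.\<close>

lemma sys_fiedler_prod_blocks:
  fixes L R :: "nat list"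
  assumes d: "dA \<ge> 1" "dD \<ge> 1" and Ac: "\<forall>j<dA. Ac j \<in> carrier_mat n n" and Dc: "\<forall>j<dD. Dc j \<in> carrier_mat m m"
    and K: "kron (ecol dA dA * transpose_mat (ecol dD dD)) B \<in> carrier_mat (dA * n) (dD * m)" (is "?B \<in> _")
      "kron (ecol dD dD * transpose_mat (ecol dA dA)) C \<in> carrier_mat (dD * m) (dA * n)" (is "?C \<in> _")
    and LR: "0 \<notin> set L" "0 \<notin> set R"
    and split: "map (the_inv_into {0..<max dA dD} \<sigma>) [1..<max dA dD + 1] = L @ 0 # R"
  shows "sys_fiedler_prod Ac Dc B C n m dA dD \<sigma> =
    four_block_mat (fprod Ac n dA (L @ 0 # R)) (fprod Ac n dA L * ?B * fprod Dc m dD R)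
      (- (fprod Dc m dD L * ?C * fprod Ac n dA R)) (fprod Dc m dD (L @ 0 # R))"
proof -
  note A = fprod_carrier[OF d(1) Ac] fiedler_carrier[OF d(1) Ac]
  note D = fprod_carrier[OF d(2) Dc] fiedler_carrier[OF d(2) Dc]
  have dims: "dim_row (fprod Ac n dA zs) = dA * n" "dim_col (fprod Ac n dA zs) = dA * n"
    "dim_row (fiedler Ac n dA i) = dA * n" "dim_col (fiedler Ac n dA i) = dA * n"
    "dim_row (fprod Dc m dD zs) = dD * m" "dim_col (fprod Dc m dD zs) = dD * m"
    "dim_row (fiedler Dc m dD i) = dD * m" "dim_col (fiedler Dc m dD i) = dD * m" for zs i
    using A(1)[of zs] A(2)[of i] D(1)[of zs] D(2)[of i] by auto
  note dimsK = carrier_matD[OF K(1)] carrier_matD[OF K(2)]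
  have dim0: "dim_row (sys_fiedler Ac Dc B C n m dA dD 0) = dA * n + dD * m"
    "dim_col (sys_fiedler Ac Dc B C n m dA dD 0) = dA * n + dD * m" by (simp_all add: sys_fiedler_def dims)
  have "sys_fiedler_prod Ac Dc B C n m dA dD \<sigma>
    = foldr (\<lambda>i P. sys_fiedler Ac Dc B C n m dA dD i * P) (L @ 0 # R) (1\<^sub>m (dA * n + dD * m))"
    unfolding sys_fiedler_prod_def Let_def split[symmetric] by (simp add: foldr_map comp_def)
  \<comment> \<open>\<open>foldr_sys_fiedler\<close> is used for \<open>L\<close> and for
    \<open>R\<close>, each time with the rest of the product as trailing factor.\<close>
  also have "\<dots> = bdiag (fprod Ac n dA L) (fprod Dc m dD L) * (sys_fiedler Ac Dc B C n m dA dD 0 *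
      (bdiag (fprod Ac n dA R) (fprod Dc m dD R) * 1\<^sub>m (dA * n + dD * m)))"
    using d Ac Dc LR by (simp add: foldr_sys_fiedler dim0 dims mat_one_zero_dim)
  also have "\<dots> = bdiag (fprod Ac n dA L) (fprod Dc m dD L) * sys_fiedler Ac Dc B C n m dA dD 0 *
      bdiag (fprod Ac n dA R) (fprod Dc m dD R)"
    by (simp add: sys_fiedler_def dims mat_one_zero_dim mat_mult_assoc_dim)
  also have "\<dots> = four_block_mat (fprod Ac n dA L * fiedler Ac n dA 0 * fprod Ac n dA R) (fprod Ac n dA L * ?B * fprod Dc m dD R)
      (fprod Dc m dD L * - ?C * fprod Ac n dA R) (fprod Dc m dD L * fiedler Dc m dD 0 * fprod Dc m dD R)"
    unfolding sys_fiedler_def if_P[OF refl]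
    by (rule bdiag_four_block_bdiag) (use A D K in auto)
  finally show ?thesis
    by (simp add: fprod_append[OF d(1) Ac] fprod_append[OF d(2) Dc] fprod_Cons mat_mult_assoc_dim
        mat_mult_distrib_dim dims dimsK)
qed

text \<open>The inverse bijection lists the indices in the order of the factors, and index 0 occurs
  exactly once.\<close>

lemma permutation_list_split:
  fixes d :: nat
  assumes bij: "bij_betw \<sigma> {0..<d} {1..d}" and "d \<ge> 1"
  obtains L R where "map (the_inv_into {0..<d} \<sigma>) [1..<d + 1] = L @ 0 # R" "distinct (L @ 0 # R)"
    "set (L @ 0 # R) = {0..<d}"
proof -
  let ?xs = "map (the_inv_into {0..<d} \<sigma>) [1..<d + 1]"
  have inv: "bij_betw (the_inv_into {0..<d} \<sigma>) {1..d} {0..<d}" by (rule bij_betw_the_inv_into[OF bij])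
  have "set [1..<d + 1] = {1..d}" by auto
  then have set: "set ?xs = {0..<d}" and dist: "distinct ?xs"
    using inv by (auto simp: bij_betw_def distinct_map)
  then have "0 \<in> set ?xs" using \<open>d \<ge> 1\<close> by simp
  then obtain L R where "?xs = L @ 0 # R" by (meson split_list)
  with set dist that show thesis by metis
qed

section \<open>Linearization of the Rosenbrock system\<close>

theorem mainTheorem4:
  fixes n m dA dD :: nat and Ac Dc :: "nat \<Rightarrow> complex mat" and B C :: "complex mat"
    and \<sigma> :: "nat \<Rightarrow> nat"
  assumes "n \<ge> 1" "m \<ge> 1" "dA \<ge> 1" "dD \<ge> 1"
    and "\<forall>j\<le>dA. Ac j \<in> carrier_mat n n"
    and "\<forall>j\<le>dD. Dc j \<in> carrier_mat m m"
    and "B \<in> carrier_mat n m" and "C \<in> carrier_mat m n"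
    and "bij_betw \<sigma> {0..<max dA dD} {1..max dA dD}"
  shows
   "(\<exists>UA VA UD VD.
      unimodular (dA * n) UA \<and> unimodular (dA * n) VA \<and>
      unimodular (dD * m) UD \<and> unimodular (dD * m) VD \<and>
      bdiag UA UD * fiedler_pencil Ac Dc B C n m dA dD \<sigma> * bdiag VA VD =
      four_block_mat
        (bdiag (- 1\<^sub>m ((dA - 1) * n)) (mat_poly n dA Ac))
        (- cpoly_mat (kron (ecol dA dA * transpose_mat (ecol dD dD)) B))
        (cpoly_mat (kron (ecol dD dD * transpose_mat (ecol dA dA)) C))
        (bdiag (- 1\<^sub>m ((dD - 1) * m)) (mat_poly m dD Dc)))
   \<and> (\<exists>U V.
      unimodular (dA * n + dD * m) U \<and> unimodular (dA * n + dD * m) V \<and>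
      U * fiedler_pencil Ac Dc B C n m dA dD \<sigma> * V =
      bdiag (1\<^sub>m ((dA - 1) * n)) (bdiag (1\<^sub>m ((dD - 1) * m))
        (four_block_mat (mat_poly n dA Ac) (- cpoly_mat B) (cpoly_mat C) (mat_poly m dD Dc))))"
proof -
  let ?a = "(dA - 1) * n" and ?b = "(dD - 1) * m"
  let ?KB = "kron (ecol dA dA * transpose_mat (ecol dD dD)) B"
  let ?KC = "kron (ecol dD dD * transpose_mat (ecol dA dA)) C"
  let ?L = "fiedler_pencil Ac Dc B C n m dA dD \<sigma>"
  have "max dA dD \<ge> 1" using assms(3) by simp
  then obtain L R where split: "map (the_inv_into {0..<max dA dD} \<sigma>) [1..<max dA dD + 1] = L @ 0 # R"
    and dist: "distinct (L @ 0 # R)" and set: "set (L @ 0 # R) = {0..<max dA dD}"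
    by (rule permutation_list_split[OF assms(9)])
  have LR: "0 \<notin> set L" "0 \<notin> set R" using dist by auto
  \<comment> \<open>The list reaches up to the larger degree, so it covers the indices required by
    either polynomial.\<close>
  have sub: "{0..<dA} \<subseteq> set (L @ 0 # R)" "{0..<dD} \<subseteq> set (L @ 0 # R)" unfolding set by auto
  have Ac: "\<forall>j<dA. Ac j \<in> carrier_mat n n" and Dc: "\<forall>j<dD. Dc j \<in> carrier_mat m m"
    using assms(5,6) by auto
  have N: "?a + n = dA * n" "?b + m = dD * m"
    using assms(3,4) by (simp_all only: pred_mult_add)
  note kB = kron_ecol[OF assms(3,4,7)] and kC = kron_ecol[OF assms(4,3,8)]
  have KB: "?KB \<in> carrier_mat (dA * n) (dD * m)" and KC: "?KC \<in> carrier_mat (dD * m) (dA * n)"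
    unfolding kB kC using assms(7,8) N by (auto intro!: carrier_matI)
  have corner: "proj_last n dA * cpoly_mat ?KB * proj_last m dD = cpoly_mat ?KB"
      "proj_last m dD * cpoly_mat ?KC * proj_last n dA = cpoly_mat ?KC"
    using arg_cong[OF proj_last_corner[OF assms(7), of dA dD, folded kB], of cpoly_mat]
      arg_cong[OF proj_last_corner[OF assms(8), of dD dA, folded kC], of cpoly_mat] assms(3,4) KB KC
    by (simp_all add: cpoly_mult cpoly_proj_last)
  obtain UA VA where UA: "unimodular (dA * n) UA" "unimodular (dA * n) VA"
    "UA * (lam_mat (fiedler_lead Ac n dA) - cpoly_mat (fprod Ac n dA (L @ 0 # R))) * VA
      = bdiag (- 1\<^sub>m ?a) (mat_poly n dA Ac)"
    "UA * cpoly_mat (fprod Ac n dA L * proj_last n dA) = proj_last n dA"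
    "cpoly_mat (proj_last n dA * fprod Ac n dA R) * VA = proj_last n dA"
    by (rule fiedler_linearization[OF assms(3,5) dist sub(1)])
  obtain UD VD where UD: "unimodular (dD * m) UD" "unimodular (dD * m) VD"
    "UD * (lam_mat (fiedler_lead Dc m dD) - cpoly_mat (fprod Dc m dD (L @ 0 # R))) * VD
      = bdiag (- 1\<^sub>m ?b) (mat_poly m dD Dc)"
    "UD * cpoly_mat (fprod Dc m dD L * proj_last m dD) = proj_last m dD"
    "cpoly_mat (proj_last m dD * fprod Dc m dD R) * VD = proj_last m dD"
    by (rule fiedler_linearization[OF assms(4,6) dist sub(2)])
  have carU: "UA \<in> carrier_mat (dA * n) (dA * n)" "VA \<in> carrier_mat (dA * n) (dA * n)"
    "UD \<in> carrier_mat (dD * m) (dD * m)" "VD \<in> carrier_mat (dD * m) (dD * m)"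
    using UA(1,2) UD(1,2) by (auto simp: unimodular_def)
  note fA = fprod_carrier[OF assms(3) Ac] and fD = fprod_carrier[OF assms(4) Dc]
  have dims: "dim_row (fprod Ac n dA zs) = dA * n" "dim_col (fprod Ac n dA zs) = dA * n"
    "dim_row (fprod Dc m dD zs) = dD * m" "dim_col (fprod Dc m dD zs) = dD * m" for zs
    using fA[of zs] fD[of zs] by auto
  note dimsK = carrier_matD[OF KB] carrier_matD[OF KC]
  have lA: "lam_mat (fiedler_lead Ac n dA) \<in> carrier_mat (dA * n) (dA * n)"
    and lD: "lam_mat (fiedler_lead Dc m dD) \<in> carrier_mat (dD * m) (dD * m)"
    using assms(5,6) N by (auto simp: lam_mat_fiedler_lead add.commute intro!: carrier_matI)
  let ?Q = "fprod Ac n dA L * ?KB * fprod Dc m dD R" and ?R = "fprod Dc m dD L * ?KC * fprod Ac n dA R"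
  have lam_bdiag: "lam_mat (bdiag X Y) = bdiag (lam_mat X) (lam_mat Y)" for X Y
    by (simp add: lam_mat_def map_mat_bdiag)
  have "?L = bdiag (lam_mat (fiedler_lead Ac n dA)) (lam_mat (fiedler_lead Dc m dD))
    - four_block_mat (cpoly_mat (fprod Ac n dA (L @ 0 # R))) (cpoly_mat ?Q) (- cpoly_mat ?R)
        (cpoly_mat (fprod Dc m dD (L @ 0 # R)))"
    unfolding fiedler_pencil_def sys_fiedler_lead_def lam_bdiag
      sys_fiedler_prod_blocks[OF assms(3,4) Ac Dc KB KC LR split]
    by (simp add: cpoly_four_block dims)
  also have "\<dots> = four_block_mat (lam_mat (fiedler_lead Ac n dA) - cpoly_mat (fprod Ac n dA (L @ 0 # R)))
      (- cpoly_mat ?Q) (- (- cpoly_mat ?R)) (lam_mat (fiedler_lead Dc m dD) - cpoly_mat (fprod Dc m dD (L @ 0 # R)))"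
    by (rule mat_minus_four_block[OF lA lD]) (auto simp: dims intro!: carrier_matI)
  finally have pencil: "?L = four_block_mat
      (lam_mat (fiedler_lead Ac n dA) - cpoly_mat (fprod Ac n dA (L @ 0 # R)))
      (- cpoly_mat ?Q) (cpoly_mat ?R) (lam_mat (fiedler_lead Dc m dD) - cpoly_mat (fprod Dc m dD (L @ 0 # R)))"
    by simp
  \<comment> \<open>Projections are inserted on both sides of \<open>K\<close>; \<open>U\<close>
    then absorbs \<open>F\<close>, \<open>V\<close> absorbs \<open>G\<close>, and the projections
    are removed again.\<close>
  have off_diag: "U * cpoly_mat (F * K * G) * V = cpoly_mat K"
    if "U * cpoly_mat (F * proj_last p i) = proj_last p i" "cpoly_mat (proj_last q j * G) * V = proj_last q j"
      "proj_last p i * cpoly_mat K * proj_last q j = cpoly_mat K" "i \<ge> 1" "j \<ge> 1"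
      "dim_col U = i * p" "dim_row F = i * p" "dim_col F = i * p" "dim_row K = i * p" "dim_col K = j * q"
      "dim_row G = j * q" "dim_col G = j * q" "dim_row V = j * q" for U V F G K p q i j
  proof -
    have "U * cpoly_mat (F * K * G) * V = U * (cpoly_mat F * cpoly_mat K * cpoly_mat G) * V"
      using that(4-) by (simp add: cpoly_mult)
    also have "\<dots> = U * (cpoly_mat F * (proj_last p i * cpoly_mat K * proj_last q j) * cpoly_mat G) * V"
      unfolding that(3) ..
    also have "\<dots> = (U * cpoly_mat (F * proj_last p i)) * cpoly_mat K * (cpoly_mat (proj_last q j * G) * V)"
      using that(4-) by (simp add: cpoly_mult cpoly_proj_last mat_mult_assoc_dim)
    finally show ?thesis unfolding that(1,2,3) .
  qed
  have Q: "UA * cpoly_mat ?Q * VD = cpoly_mat ?KB" and R: "UD * cpoly_mat ?R * VA = cpoly_mat ?KC"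
    using carU assms(3,4)
    by (auto intro!: off_diag[OF UA(4) UD(5) corner(1)] off_diag[OF UD(4) UA(5) corner(2)] simp: dims dimsK)
  have first: "bdiag UA UD * ?L * bdiag VA VD = four_block_mat (bdiag (- 1\<^sub>m ?a) (mat_poly n dA Ac))
        (- cpoly_mat ?KB) (cpoly_mat ?KC) (bdiag (- 1\<^sub>m ?b) (mat_poly m dD Dc))" (is "_ = ?T")
  proof -
    have "bdiag UA UD * ?L * bdiag VA VD = four_block_mat
      (UA * (lam_mat (fiedler_lead Ac n dA) - cpoly_mat (fprod Ac n dA (L @ 0 # R))) * VA)
      (UA * (- cpoly_mat ?Q) * VD) (UD * cpoly_mat ?R * VA)
      (UD * (lam_mat (fiedler_lead Dc m dD) - cpoly_mat (fprod Dc m dD (L @ 0 # R))) * VD)"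
      unfolding pencil by (rule bdiag_four_block_bdiag) (use carU lA lD in \<open>auto simp: dims intro!: carrier_matI\<close>)
    moreover have "UA * (- cpoly_mat ?Q) * VD = - (UA * cpoly_mat ?Q * VD)"
      using carU by (simp add: mat_mult_distrib_dim dims)
    ultimately show ?thesis unfolding Q R UA(3) UD(3) by simp
  qed
  \<comment> \<open>The Kronecker products are expanded into corner blocks, the form required by
    \<open>rosenbrock_to_diag\<close>.\<close>
  have T: "?T = four_block_mat (bdiag (- 1\<^sub>m ?a) (mat_poly n dA Ac))
      (four_block_mat (0\<^sub>m ?a ?b) (0\<^sub>m ?a m) (0\<^sub>m n ?b) (- cpoly_mat B))
      (four_block_mat (0\<^sub>m ?b ?a) (0\<^sub>m ?b n) (0\<^sub>m m ?a) (cpoly_mat C)) (bdiag (- 1\<^sub>m ?b) (mat_poly m dD Dc))"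
  proof (rule cong_four_block_mat[OF refl _ _ refl])
    show "- cpoly_mat ?KB = four_block_mat (0\<^sub>m ?a ?b) (0\<^sub>m ?a m) (0\<^sub>m n ?b) (- cpoly_mat B)"
      unfolding kB using assms(7) by (intro eq_matI) (auto simp: cpoly_mat_def)
    show "cpoly_mat ?KC = four_block_mat (0\<^sub>m ?b ?a) (0\<^sub>m ?b n) (0\<^sub>m m ?a) (cpoly_mat C)"
      unfolding kC using assms(8) by (simp add: cpoly_four_block)
  qed
  obtain U V where U: "unimodular (dA * n + dD * m) U" "unimodular (dA * n + dD * m) V"
    "U * ?T * V = bdiag (1\<^sub>m ?a) (bdiag (1\<^sub>m ?b)
        (four_block_mat (mat_poly n dA Ac) (- cpoly_mat B) (cpoly_mat C) (mat_poly m dD Dc)))"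
    unfolding T
    by (rule rosenbrock_to_diag[where A="mat_poly n dA Ac" and D="mat_poly m dD Dc" and n=n and m=m
        and B="- cpoly_mat B" and C="cpoly_mat C" and a="?a" and b="?b", unfolded N])
      (use assms(7,8) in \<open>auto simp: mat_poly_def\<close>)
  \<comment> \<open>The equivalence composes the block diagonal transformation with the signed
    reordering of blocks.\<close>
  have uU: "unimodular (dA * n + dD * m) (U * bdiag UA UD)" "unimodular (dA * n + dD * m) (bdiag VA VD * V)"
    using U(1,2) UA(1,2) UD(1,2) by (auto intro: unimodular_mult unimodular_bdiag)
  have "U \<in> carrier_mat (dA * n + dD * m) (dA * n + dD * m)" "V \<in> carrier_mat (dA * n + dD * m) (dA * n + dD * m)"
    using U(1,2) by (auto simp: unimodular_def)
  moreover have "dim_row ?L = dA * n + dD * m" "dim_col ?L = dA * n + dD * m"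
    unfolding pencil by (auto simp: dims)
  ultimately have "U * bdiag UA UD * ?L * (bdiag VA VD * V) = U * (bdiag UA UD * ?L * bdiag VA VD) * V"
    using carU by (simp add: mat_mult_assoc_dim)
  with first U(3) have second: "U * bdiag UA UD * ?L * (bdiag VA VD * V) = bdiag (1\<^sub>m ?a) (bdiag (1\<^sub>m ?b)
        (four_block_mat (mat_poly n dA Ac) (- cpoly_mat B) (cpoly_mat C) (mat_poly m dD Dc)))" by simp
  show ?thesis using first second uU UA(1,2) UD(1,2) by blast
qed

end
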